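(* Let $\mathbb{F}_q$ be a finite field with $q$ elements, let $A=\mathbb{F}_q[X]$, let $\widehat K=\mathbb{F}_q((X^{-1}))$, and let $Q_0$ be a fixed non-zero element of $A$. Let $\varphi:\mathbb{R}_+\to\mathbb{R}_+$ be a map such that $u\mapsto\log\varphi(e^u)$ is Lipschitz on $\mathbb{R}_+$. If the integral $\int_1^{+\infty}\varphi(t)/t\;dt$ diverges (respectively converges), then for almost every (respectively almost no) $f$ in $\widehat K$, there exist infinitely many couples $(P,Q)$ in $A\times(A-\{0\})$, where $P$ is coprime with $Q$ and $Q$ is divisible by $Q_0$, such that $$\left|f-\frac{P}{Q}\right|_\infty\leq\frac{\varphi(|Q|_\infty)}{|Q|_\infty^2}.$$
   Context: $\widehat K=\mathbb{F}_q((X^{-1}))$ is the field of formal Laurent series in $X^{-1}$ over $\mathbb{F}_q$. For $f\in\widehat K-\{0\}$, written $f=\sum_{i=n}^\infty a_iX^{-i}$ with $a_n\neq0$, $n\in\mathbb{Z}$, set $|f|_\infty=q^{-n}$; and $|0|_\infty=0$. "Almost every" and "almost no" are with respect to the Haar measure of the locally compact additive group $\widehat K$ ("for almost no $f$" means that the set of such $f$ has measure zero). *)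

theory Defs
  imports
    "HOL-Analysis.Analysis"
    "HOL-Computational_Algebra.Formal_Laurent_Series"
begin

text \<open>
  The finite field with \<open>q = CARD('a)\<close> elements is a type \<open>'a :: {finite, field}\<close>, and
  \<^typ>\<open>'a fls\<close> is read as the field of formal Laurent series in \<open>X\<close>-inverse over it:
  the formal variable \<^const>\<open>fls_X\<close> of the library stands for \<open>X\<close>-inverse, and
  \<^const>\<open>fls_X_inv\<close> stands for \<open>X\<close>. So \<^const>\<open>fls_subdegree\<close> is the least exponent of
  \<open>X\<close>-inverse with a nonzero coefficient.
\<close>

definition abs_inf :: "'a::{finite,field} fls \<Rightarrow> real" where
  "abs_inf f = (if f = 0 then 0 else real CARD('a) powi (- fls_subdegree f))"

text \<open>
  The embedding of the polynomial ring: evaluation at \<open>X\<close>, that is, at \<^const>\<open>fls_X_inv\<close>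
  (not at \<^const>\<open>fls_X\<close>).
\<close>

definition embed_poly :: "'a::{finite,field} poly \<Rightarrow> 'a fls" where
  "embed_poly P = poly (map_poly fls_const P) fls_X_inv"

text \<open>
  The metric topology that the library puts on \<^typ>\<open>'a fls\<close> (powers of 2 in place of powers of
  \<open>q\<close>) has the same balls as \<^const>\<open>abs_inf\<close>, hence is the usual locally compact topology. As it
  is second countable, every Borel measure that is finite on compact sets is regular, so no
  regularity clause is needed here. A Haar measure is unique up to a positive factor, so it is
  introduced as a predicate.
\<close>

definition haar_measure :: "'a::{finite,field} fls measure \<Rightarrow> bool" where
  "haar_measure M \<longleftrightarrow>
     sets M = sets borel \<and>
     emeasure M UNIV \<noteq> 0 \<and>
     (\<forall>C. compact C \<longrightarrow> emeasure M C < \<infinity>) \<and>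
     (\<forall>a. \<forall>B\<in>sets borel. emeasure M ((+) a ` B) = emeasure M B)"

definition good_couples ::
    "'a::{finite,field} poly \<Rightarrow> (real \<Rightarrow> real) \<Rightarrow> 'a fls \<Rightarrow> ('a poly \<times> 'a poly) set" where
  "good_couples Q0 \<phi> f =
     {(P, Q). Q \<noteq> 0 \<and> coprime P Q \<and> Q0 dvd Q \<and>
        abs_inf (f - embed_poly P / embed_poly Q)
          \<le> \<phi> (abs_inf (embed_poly Q)) / (abs_inf (embed_poly Q))\<^sup>2}"

end

theory Submission
  imports Defs
begin

text \<open>
  The Lipschitz condition makes the integral comparable to the series \<open>\<Sum>n. \<phi> (q ^ n)\<close>.
  If it converges, count the fractions with denominator of degree \<open>n\<close> in the unit ball and
  apply the Borel-Cantelli lemma. If it diverges, let \<open>Z\<close> be the product of \<open>Q0\<close> and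
  all monic linear polynomials. Sieving the pairs \<open>(P, Z * Q)\<close> with \<open>P \<equiv> 1 (mod Z)\<close> by their common
  factors shows that every ball \<open>B\<close> contains a positive proportion of the maximal possible number
  of reduced fractions with denominator \<open>Z * Q\<close>, \<open>degree Q = m\<close>, once \<open>m\<close> is large. Distinct such
  fractions are well separated, so the sets of points close to fractions of different degrees are
  quasi-independent within \<open>B\<close>, and their union over all \<open>m \<ge> a\<close> fills at least a fixed proportion
  of \<open>B\<close>, independent of \<open>B\<close> and \<open>a\<close>. As in the Lebesgue density theorem, that union has full measure.
\<close>

text \<open>Since \<open>abs_inf\<close> is ultrametric with only powers of \<open>q\<close> as
  nonzero values, every closed ball of positive radius at most 1 is a cylinder
  \<open>cyl b k\<close>, and cylinders of equal depth are equal or disjoint. So counting centres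
  takes the place of covering arguments, and \<phi> may be rounded to powers of \<open>q\<close> at
  the cost of a factor \<open>q\<close>. Two features shape the divergence half. The pairwise bound
  has no additive error: if neighbourhoods of two fractions of different degrees meet, their
  separation forces the wider one to be so wide that the number of finer fractions inside it is at
  most proportional to its measure. And the counting is done relative to an arbitrary cylinder, with
  a proportion that does not depend on it, although the degree from which it holds does. This local
  form yields full measure directly, where a global second-moment bound would give only positive
  measure and call for a zero-one law.\<close>

unbundle fps_syntax

section \<open>Cylinders and Haar measure\<close>

text \<open>The closed ball of radius \<open>q\<close> to the power \<open>- k\<close> around
  \<open>b\<close>, with \<open>q\<close> standing for \<open>CARD('a)\<close>. The index runs over
  the negative integers too, so all members share the coefficients of \<open>b\<close> there. Depths
  are natural numbers, since only radii at most 1 occur.\<close>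

definition cyl :: "'a::{finite,field} fls \<Rightarrow> nat \<Rightarrow> 'a fls set" where
  "cyl b k = {f. \<forall>i<int k. f $$ i = b $$ i}"

lemma mem_cyl_self [simp]: "b \<in> cyl b k"
  by (simp add: cyl_def)

lemma cyl_eq: "x \<in> cyl b k \<Longrightarrow> cyl x k = cyl b k"
  by (auto simp: cyl_def)

lemma cyl_mono: "k \<le> l \<Longrightarrow> cyl b l \<subseteq> cyl b k"
  by (auto simp: cyl_def)

lemma cyl_subset: "x \<in> cyl b k \<Longrightarrow> k \<le> l \<Longrightarrow> cyl x l \<subseteq> cyl b k"
  using cyl_eq cyl_mono by blast

lemma cyl_sym: "x \<in> cyl b k \<longleftrightarrow> b \<in> cyl x k"
  by (auto simp: cyl_def)

lemma dist_less_imp_mem_cyl: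
  assumes "dist f b < 1 / 2 ^ k"
  shows "f \<in> cyl b k"
proof (cases "f = b")
  case False
  have "fls_subdegree (f - b) > int k"
  proof (rule ccontr)
    assume *: "\<not> ?thesis"
    show False
    proof (cases "fls_subdegree (f - b) \<ge> 0")
      case True
      with * have "nat (fls_subdegree (f - b)) \<le> k" by simp
      then have "(2::real) ^ nat (fls_subdegree (f - b)) \<le> 2 ^ k"
        by (intro power_increasing) auto
      then have "1 / 2 ^ k \<le> inverse ((2::real) ^ nat (fls_subdegree (f - b)))"
        by (simp add: field_simps)
      then show False using assms False True by (simp add: dist_fls_def)
    next
      case neg: False
      have "1 / 2 ^ k \<le> (1::real)" by simp
      also have "\<dots> \<le> 2 ^ nat (- fls_subdegree (f - b))" by simp
      finally show False using assms False neg by (simp add: dist_fls_def)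
    qed
  qed
  then have "(f - b) $$ i = 0" if "i < int k" for i
    using that by (intro fls_eq0_below_subdegree) auto
  then show ?thesis by (simp add: cyl_def)
qed simp

lemma mem_cyl_imp_dist_le:
  assumes "f \<in> cyl b k"
  shows "dist f b \<le> 1 / 2 ^ k"
proof (cases "f = b")
  case False
  then have "fls_subdegree (f - b) \<ge> int k"
    using assms by (intro fls_subdegree_geI) (auto simp: cyl_def)
  moreover from this have "(2::real) ^ k \<le> 2 ^ nat (fls_subdegree (f - b))"
    by (intro power_increasing) auto
  ultimately show ?thesis using False by (simp add: dist_fls_def field_simps)
qed simp

lemma open_cyl: "open (cyl b k)"
  unfolding open_fls_def
proof (intro ballI exI conjI)
  fix f assume "f \<in> cyl b k"
  then show "{y. dist y f < 1 / 2 ^ k} \<subseteq> cyl b k"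
    using dist_less_imp_mem_cyl cyl_eq by blast
qed simp

lemma closed_cyl: "closed (cyl b k)"
proof -
  have "- cyl b k = (\<Union>x\<in>- cyl b k. cyl x k)"
  proof (intro equalityI subsetI)
    fix f assume "f \<in> (\<Union>x\<in>- cyl b k. cyl x k)"
    then show "f \<in> - cyl b k" using cyl_eq[of f _ k] by (metis ComplD ComplI UN_E mem_cyl_self)
  qed (blast intro: mem_cyl_self)
  also have "open \<dots>" by (intro open_UN ballI open_cyl)
  finally show ?thesis by (simp add: closed_def)
qed

lemma cyl_Suc:
  fixes b :: "'a::{finite,field} fls"
  shows "cyl b k = (\<Union>c. cyl (b + fls_shift (- int k) (fls_const c)) (Suc k))"
proof (intro equalityI subsetI)
  fix f assume "f \<in> cyl b k"
  then have "f \<in> cyl (b + fls_shift (- int k) (fls_const (f $$ int k - b $$ int k))) (Suc k)"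
    by (auto simp: cyl_def)
  then show "f \<in> (\<Union>c. cyl (b + fls_shift (- int k) (fls_const c)) (Suc k))" by blast
qed (auto simp: cyl_def)

lemma disjoint_cyl_Suc:
  "disjoint_family (\<lambda>c. cyl (b + fls_shift (- int k) (fls_const c)) (Suc k))"
proof (unfold disjoint_family_on_def, intro ballI impI equals0I)
  fix c d :: 'a and f assume "c \<noteq> d"
    "f \<in> cyl (b + fls_shift (- int k) (fls_const c)) (Suc k) \<inter>
         cyl (b + fls_shift (- int k) (fls_const d)) (Suc k)"
  then have "f $$ int k = (b + fls_shift (- int k) (fls_const c)) $$ int k"
    "f $$ int k = (b + fls_shift (- int k) (fls_const d)) $$ int k"
    unfolding cyl_def by (auto dest: spec[of _ "int k"] simp del: fls_plus_nth)
  then show False using \<open>c \<noteq> d\<close> by simp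
qed

lemma cyl_finite_cover:
  fixes b :: "'a::{finite,field} fls"
  obtains K where "finite K" "card K \<le> CARD('a) ^ n" "cyl b k = (\<Union>x\<in>K. cyl x (k + n))"
proof -
  have "\<exists>K. finite K \<and> card K \<le> CARD('a) ^ n \<and> cyl b k = (\<Union>x\<in>K. cyl x (k + n))"
  proof (induction n)
    case 0
    show ?case by (intro exI[of _ "{b}"]) simp
  next
    case (Suc n)
    then obtain K where K: "finite K" "card K \<le> CARD('a) ^ n"
      "cyl b k = (\<Union>x\<in>K. cyl x (k + n))" by blast
    let ?K = "(\<lambda>(x, c). x + fls_shift (- int (k + n)) (fls_const c)) ` (K \<times> UNIV)"
    have "cyl b k = (\<Union>x\<in>K. \<Union>c. cyl (x + fls_shift (- int (k + n)) (fls_const c)) (k + Suc n))"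
      unfolding K(3) add_Suc_right by (rule SUP_cong[OF refl cyl_Suc])
    also have "\<dots> = (\<Union>x\<in>?K. cyl x (k + Suc n))" by (simp only: image_image UN_simps split_beta SUP_UNION) force
    finally have "cyl b k = (\<Union>x\<in>?K. cyl x (k + Suc n))" .
    moreover have "card ?K \<le> card K * CARD('a)"
      using card_image_le[of "K \<times> (UNIV :: 'a set)"] K(1) by (simp add: card_cartesian_product)
    then have "card ?K \<le> CARD('a) ^ Suc n"
      using mult_right_mono[OF K(2), of "CARD('a)"] by (simp only: power_Suc2 mult.commute) linarith
    ultimately show ?case using K(1) by (intro exI[of _ ?K]) auto
  qed
  then show ?thesis using that by blast
qed

text \<open>Pigeonhole on the subcylinders of depth \<open>k + n\<close>: separation lets each
  contain at most one point of \<open>S\<close>. Every upper bound for a number of fractions comes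
  from here.\<close>

lemma card_separated_subset_cyl:
  fixes b :: "'a::{finite,field} fls"
  assumes "S \<subseteq> cyl b k" and sep: "\<And>x y. x \<in> S \<Longrightarrow> y \<in> S \<Longrightarrow> x \<in> cyl y (k + n) \<Longrightarrow> x = y"
  shows "finite S" "card S \<le> CARD('a) ^ n"
proof -
  obtain K where K: "finite K" "card K \<le> CARD('a) ^ n" "cyl b k = (\<Union>x\<in>K. cyl x (k + n))"
    by (rule cyl_finite_cover)
  then have "\<forall>x\<in>S. \<exists>z\<in>K. x \<in> cyl z (k + n)" using assms(1) by blast
  then obtain h where h: "\<And>x. x \<in> S \<Longrightarrow> h x \<in> K" "\<And>x. x \<in> S \<Longrightarrow> x \<in> cyl (h x) (k + n)"
    by metis
  have "inj_on h S"
    using sep h(2) cyl_eq by (metis inj_onI)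
  moreover have "h ` S \<subseteq> K" using h(1) by blast
  ultimately show "finite S" "card S \<le> CARD('a) ^ n"
    using K inj_on_finite card_inj_on_le order_trans by metis+
qed

text \<open>A Cauchy sequence converges coefficientwise; the limit is a Laurent series because
  inside one cylinder all terms share the coefficients at negative indices, and hence a common bound
  for their supports from below.\<close>

lemma complete_cyl: "complete (cyl b k)"
proof (rule completeI)
  fix x assume x: "\<forall>n. x n \<in> cyl b k" "Cauchy x"
  have "\<exists>N. \<forall>n\<ge>N. x n \<in> cyl (x N) m" for m
  proof -
    obtain N where "\<forall>i\<ge>N. \<forall>j\<ge>N. dist (x i) (x j) < 1 / 2 ^ m"
      using x(2) unfolding Cauchy_def by (meson zero_less_divide_1_iff zero_less_numeral zero_less_power)
    then show ?thesis using dist_less_imp_mem_cyl by blast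
  qed
  then obtain N where N: "\<And>m n. n \<ge> N m \<Longrightarrow> x n \<in> cyl (x (N m)) m" by metis
  \<comment> \<open>Beyond \<open>N (nat (i + 1))\<close> the coefficient at \<open>i\<close> is
    frozen, as \<open>i < i + 1\<close>. For negative \<open>i\<close> any term of the sequence
    would do.\<close>
  define g where "g i = x (N (nat (i + 1))) $$ i" for i
  obtain M where M: "\<forall>i<M. b $$ i = 0" by (rule fls_nth_vanishes_belowE)
  have "\<exists>M. \<forall>i<M. g i = 0"
    using M x(1) by (intro exI[of _ "min M 0"]) (auto simp: g_def cyl_def)
  then have l: "Abs_fls g $$ i = g i" for i by (rule nth_Abs_fls_ex_lower_bound)
  have close: "x n \<in> cyl (Abs_fls g) m" if "n \<ge> N m" "m \<ge> k" for n m
    unfolding cyl_def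
  proof (intro CollectI allI impI)
    fix i assume i: "i < int m"
    have m1: "x (max n (N (nat (i + 1)))) $$ i = x n $$ i"
      using N[of m n] N[of m "max n (N (nat (i + 1)))"] i that(1) by (simp add: cyl_def)
    show "x n $$ i = Abs_fls g $$ i"
    proof (cases "i < 0")
      case True
      then show ?thesis using x(1) by (simp add: l g_def cyl_def)
    next
      case False
      then have "x (max n (N (nat (i + 1)))) $$ i = g i"
        using N[of "nat (i + 1)" "max n (N (nat (i + 1)))"] by (simp add: g_def cyl_def)
      then show ?thesis using m1 by (simp add: l)
    qed
  qed
  have "x \<longlonglongrightarrow> Abs_fls g"
  proof (rule metric_LIMSEQ_I)
    fix r :: real assume "r > 0"
    then obtain m where m: "1 / 2 ^ m < r"
      using real_arch_pow_inv[of r "1/2"] by (auto simp: power_one_over)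
    have "dist (x n) (Abs_fls g) < r" if "n \<ge> N (max m k)" for n
    proof -
      have "dist (x n) (Abs_fls g) \<le> 1 / 2 ^ max m k"
        using close[of "max m k" n] that by (intro mem_cyl_imp_dist_le) auto
      also have "\<dots> \<le> 1 / 2 ^ m" by (intro divide_left_mono power_increasing) auto
      finally show ?thesis using m by simp
    qed
    then show "\<exists>no. \<forall>n\<ge>no. dist (x n) (Abs_fls g) < r" by blast
  qed
  moreover have "Abs_fls g \<in> cyl b k"
    using closed_sequentially[OF closed_cyl] x(1) calculation by blast
  ultimately show "\<exists>l\<in>cyl b k. x \<longlonglongrightarrow> l" by blast
qed

text \<open>A Haar measure is only assumed finite on compact sets; compactness is what makes the
  measure of cylinders finite.\<close>

lemma compact_cyl: "compact (cyl b k)"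
  unfolding compact_eq_totally_bounded
proof (intro conjI allI impI complete_cyl)
  fix e :: real assume "e > 0"
  then obtain m where m: "1 / 2 ^ m < e"
    using real_arch_pow_inv[of e "1/2"] by (auto simp: power_one_over)
  obtain K where K: "finite K" "cyl b k = (\<Union>x\<in>K. cyl x (k + m))" by (rule cyl_finite_cover)
  have "cyl x (k + m) \<subseteq> ball x e" for x
  proof
    fix f assume "f \<in> cyl x (k + m)"
    then have "dist f x \<le> 1 / 2 ^ (k + m)" by (rule mem_cyl_imp_dist_le)
    also have "\<dots> \<le> 1 / 2 ^ m" by (intro divide_left_mono power_increasing) auto
    finally show "f \<in> ball x e" using m by (simp add: dist_commute)
  qed
  then show "\<exists>K. finite K \<and> cyl b k \<subseteq> (\<Union>x\<in>K. ball x e)"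
    using K by (intro exI[of _ K]) blast
qed

section \<open>The Haar measure of cylinders\<close>

locale haar =
  fixes M :: "'a::{finite,field} fls measure"
  assumes haar: "haar_measure M"
begin

lemma sets_M: "sets M = sets borel"
  using haar by (simp add: haar_measure_def)

lemma space_M: "space M = UNIV"
  using sets_eq_imp_space_eq[OF sets_M] by simp

lemma open_in_sets: "open S \<Longrightarrow> S \<in> sets M"
  by (simp add: sets_M)

lemma cyl_in_sets [measurable, simp]: "cyl b k \<in> sets M"
  by (intro open_in_sets open_cyl)

lemma fmeasurable_cyl [simp]: "cyl b k \<in> fmeasurable M"
  using haar by (auto intro!: fmeasurableI simp: haar_measure_def compact_cyl)

lemma emeasure_cyl_transl: "emeasure M (cyl b k) = emeasure M (cyl 0 k)"
proof -
  have "cyl b k = (+) b ` cyl 0 k"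
  proof (intro equalityI subsetI)
    fix f assume "f \<in> cyl b k"
    then have "f - b \<in> cyl 0 k" by (simp add: cyl_def)
    then show "f \<in> (+) b ` cyl 0 k" by (metis add_diff_cancel_left' add_diff_eq imageI)
  qed (auto simp: cyl_def)
  then show ?thesis using haar by (simp add: haar_measure_def open_cyl)
qed

lemma measure_cyl_transl: "measure M (cyl b k) = measure M (cyl c k)"
  using emeasure_cyl_transl[of b k] emeasure_cyl_transl[of c k] by (simp add: measure_def)

text \<open>A cylinder splits into \<open>CARD('a)\<close> disjoint cylinders of the next depth,
  which are translates of each other. The measure is not normalised:
  \<open>measure M (cyl 0 0)\<close> stays as a factor, in which all later estimates are
  homogeneous.\<close>

lemma measure_cyl: "measure M (cyl b k) = measure M (cyl 0 0) / real CARD('a) ^ k"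
proof (induction k arbitrary: b)
  case 0
  show ?case using measure_cyl_transl[of b 0 0] by simp
next
  case (Suc k)
  have "measure M (cyl 0 k) =
      measure M (\<Union>c. cyl (0 + fls_shift (- int k) (fls_const (c::'a))) (Suc k))"
    by (rule arg_cong[OF cyl_Suc])
  also have "\<dots> = (\<Sum>c\<in>UNIV. measure M (cyl (0 + fls_shift (- int k) (fls_const (c::'a))) (Suc k)))"
    using fmeasurableD2[OF fmeasurable_cyl] by (intro measure_finite_Union disjoint_cyl_Suc) auto
  also have "\<dots> = (\<Sum>c\<in>(UNIV::'a set). measure M (cyl b (Suc k)))"
    by (intro sum.cong refl measure_cyl_transl)
  finally show ?case using Suc[of 0] by (simp add: field_simps)
qed

end

section \<open>Polynomials inside the Laurent series\<close>

lemma card_field_ge_2: "2 \<le> CARD('a::{finite,field})"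
  using card_mono[of UNIV "{0, 1 :: 'a}"] by simp

lemma embed_poly_pCons: "embed_poly (pCons a P) = fls_const a + fls_X_inv * embed_poly P"
  by (simp add: embed_poly_def map_poly_pCons)

lemma nth_embed_poly: "embed_poly P $$ i = (if i \<le> 0 then coeff P (nat (- i)) else 0)"
proof (induction P arbitrary: i)
  case 0
  show ?case by (simp add: embed_poly_def)
next
  case (pCons a P)
  show ?case
  proof (cases "i < 0")
    case True
    then have "nat (- i) = Suc (nat (- (i + 1)))" by linarith
    then show ?thesis using True pCons(2)[of "i + 1"]
      by (simp add: embed_poly_pCons fls_X_inv_times_conv_shift)
  qed (use pCons(2)[of "i + 1"] in \<open>simp add: embed_poly_pCons fls_X_inv_times_conv_shift\<close>)
qed

lemma embed_poly_add: "embed_poly (P + Q) = embed_poly P + embed_poly Q"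
  by (rule fls_eqI) (simp add: nth_embed_poly)

lemma embed_poly_diff: "embed_poly (P - Q) = embed_poly P - embed_poly Q"
  by (rule fls_eqI) (simp add: nth_embed_poly)

lemma embed_poly_0 [simp]: "embed_poly 0 = 0"
  by (simp add: embed_poly_def)

lemma embed_poly_smult: "embed_poly (smult c P) = fls_const c * embed_poly P"
  by (rule fls_eqI) (simp add: nth_embed_poly)

lemma embed_poly_mult: "embed_poly (P * Q) = embed_poly P * embed_poly Q"
proof (induction P)
  case (pCons a P)
  then show ?case
    by (simp add: embed_poly_add embed_poly_smult embed_poly_pCons[of 0]
        embed_poly_pCons[of a] algebra_simps)
qed simp

lemma embed_poly_eq_0_iff [simp]: "embed_poly P = 0 \<longleftrightarrow> P = 0"
proof
  assume "embed_poly P = 0"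
  then have "coeff P n = 0" for n
    using nth_embed_poly[of P "- int n"] by simp
  then show "P = 0" by (simp add: poly_eq_iff)
qed simp

lemma embed_poly_eq_iff [simp]: "embed_poly P = embed_poly Q \<longleftrightarrow> P = Q"
  using embed_poly_eq_0_iff[of "P - Q"] by (simp add: embed_poly_diff)

lemma subdegree_embed_poly: "P \<noteq> 0 \<Longrightarrow> fls_subdegree (embed_poly P) = - int (degree P)"
  by (rule fls_subdegree_eqI) (auto simp: nth_embed_poly intro!: coeff_eq_0)

lemma abs_inf_embed_poly:
  fixes P :: "'a::{finite,field} poly"
  shows "P \<noteq> 0 \<Longrightarrow> abs_inf (embed_poly P) = real CARD('a) ^ degree P"
  by (simp add: abs_inf_def subdegree_embed_poly)

lemma embed_quotient_eq_iff:
  "Q \<noteq> 0 \<Longrightarrow> S \<noteq> 0 \<Longrightarrow>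
    embed_poly P / embed_poly Q = embed_poly R / embed_poly S \<longleftrightarrow> P * S = R * Q"
  by (simp add: frac_eq_eq flip: embed_poly_mult)

lemma mem_cyl_iff_subdegree: "f \<in> cyl b k \<longleftrightarrow> f = b \<or> int k \<le> fls_subdegree (f - b)"
proof (cases "f = b")
  case False
  then have "f - b \<noteq> 0" by simp
  show ?thesis
  proof
    assume "f \<in> cyl b k"
    then show "f = b \<or> int k \<le> fls_subdegree (f - b)"
      using False by (auto simp: cyl_def intro!: fls_subdegree_geI)
  next
    assume "f = b \<or> int k \<le> fls_subdegree (f - b)"
    then have "(f - b) $$ i = 0" if "i < int k" for i
      using that False by (intro fls_eq0_below_subdegree) auto
    then show "f \<in> cyl b k" by (simp add: cyl_def)
  qed
qed simp

lemma mem_cyl_iff_abs_inf: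
  fixes f :: "'a::{finite,field} fls"
  shows "f \<in> cyl b k \<longleftrightarrow> abs_inf (f - b) \<le> 1 / real CARD('a) ^ k"
proof -
  have "1 < real CARD('a)" using card_field_ge_2[where 'a='a] by simp
  then have "real CARD('a) powi (- fls_subdegree (f - b)) \<le> real CARD('a) powi (- int k)
      \<longleftrightarrow> int k \<le> fls_subdegree (f - b)"
    by (metis neg_le_iff_le not_less power_int_increasing power_int_strict_increasing less_imp_le)
  then show ?thesis
    by (auto simp: mem_cyl_iff_subdegree abs_inf_def power_int_minus field_simps)
qed

text \<open>Multiplication by \<open>embed_poly Q\<close> lowers the subdegree by exactly
  \<open>degree Q\<close>, so closeness of the quotient to \<open>b\<close> can be tested on the
  numerator.\<close>

lemma quotient_mem_cylI:
  assumes "Q \<noteq> 0"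
    and "\<And>i. i < int k - int (degree Q) \<Longrightarrow> embed_poly P $$ i = (b * embed_poly Q) $$ i"
  shows "embed_poly P / embed_poly Q \<in> cyl b k"
proof (cases "embed_poly P = b * embed_poly Q")
  case True
  then show ?thesis using assms(1) by simp
next
  case False
  let ?g = "embed_poly P - b * embed_poly Q"
  have "int k - int (degree Q) \<le> fls_subdegree ?g"
    using False assms(2) by (intro fls_subdegree_geI) auto
  moreover have "(embed_poly P / embed_poly Q - b) * embed_poly Q = ?g"
    using assms(1) by (simp add: field_simps)
  then have "fls_subdegree ?g = fls_subdegree (embed_poly P / embed_poly Q - b) - int (degree Q)"
    using False assms(1) by (subst \<open>_ = ?g\<close>[symmetric], subst fls_subdegree_mult)
      (auto simp: subdegree_embed_poly)
  ultimately show ?thesis by (simp add: mem_cyl_iff_subdegree)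
qed

text \<open>Two different fractions differ by a nonzero polynomial over \<open>Q * S\<close>, hence
  by at least \<open>1 / abs_inf (embed_poly (Q * S))\<close>.\<close>

lemma quotient_separation:
  assumes "Q \<noteq> 0" "S \<noteq> 0" "degree Q + degree S < k"
    and "embed_poly P / embed_poly Q \<in> cyl (embed_poly R / embed_poly S) k"
  shows "embed_poly P / embed_poly Q = embed_poly R / embed_poly S"
proof (rule ccontr)
  let ?d = "embed_poly P / embed_poly Q - embed_poly R / embed_poly S"
  assume *: "\<not> ?thesis"
  have "?d * embed_poly (Q * S) = embed_poly (P * S - R * Q)"
    using assms(1,2) by (simp add: embed_poly_mult embed_poly_diff field_simps)
  moreover have "P * S - R * Q \<noteq> 0" using * assms(1,2) by (simp add: embed_quotient_eq_iff)
  ultimately have "fls_subdegree ?d - int (degree (Q * S)) = - int (degree (P * S - R * Q))"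
    using fls_subdegree_mult[of ?d "embed_poly (Q * S)"] * assms(1,2)
    by (simp add: subdegree_embed_poly)
  moreover have "int k \<le> fls_subdegree ?d" using assms(4) * by (simp add: mem_cyl_iff_subdegree)
  ultimately show False using assms(1-3) by (simp add: degree_mult_eq)
qed

lemma ex_polynomial_part: "\<exists>F. \<forall>i\<le>0. embed_poly F $$ i = g $$ i"
proof -
  obtain N :: nat where N: "\<forall>n>N. g $$ (- int n) = 0" by (rule fls_nth_vanishes_below_natE)
  have "embed_poly (Abs_poly (\<lambda>n. g $$ (- int n))) $$ i = g $$ i" if "i \<le> 0" for i
    using that N by (simp add: nth_embed_poly coeff_Abs_poly[of N])
  then show ?thesis by blast
qed

text \<open>Described by coefficients instead of the degree so that the zero polynomial belongs to
  it even for \<open>N = 0\<close>; the cardinality is then \<open>CARD('a) ^ N\<close> without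
  exception.\<close>

definition polys_lt :: "nat \<Rightarrow> 'a::{finite,field} poly set" where
  "polys_lt N = {p. \<forall>i\<ge>N. coeff p i = 0}"

definition monics :: "nat \<Rightarrow> 'a::{finite,field} poly set" where
  "monics m = {p. degree p = m \<and> lead_coeff p = 1}"

lemma finite_card_polys_lt:
  "finite (polys_lt N :: 'a::{finite,field} poly set) \<and>
   card (polys_lt N :: 'a poly set) = CARD('a) ^ N"
proof (induction N)
  case 0
  have "polys_lt 0 = {0 :: 'a poly}" by (auto simp: polys_lt_def poly_eq_iff)
  then show ?case by simp
next
  case (Suc N)
  have "polys_lt (Suc N) = (\<lambda>(a, p). pCons a p) ` (UNIV \<times> (polys_lt N :: 'a poly set))"
  proof (intro equalityI subsetI)
    fix p :: "'a poly" assume p: "p \<in> polys_lt (Suc N)"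
    obtain a r where r: "p = pCons a r" by (cases p) auto
    have "coeff r i = 0" if "i \<ge> N" for i
      using p that by (auto simp: polys_lt_def r dest: spec[of _ "Suc i"])
    then show "p \<in> (\<lambda>(a, p). pCons a p) ` (UNIV \<times> polys_lt N)"
      unfolding r by (auto simp: polys_lt_def)
  qed (auto simp: polys_lt_def coeff_pCons split: nat.splits)
  moreover have "inj_on (\<lambda>(a, p). pCons a p) (UNIV \<times> (polys_lt N :: 'a poly set))"
    by (auto simp: inj_on_def)
  ultimately show ?case using Suc by (simp add: card_image card_cartesian_product)
qed

lemmas finite_polys_lt [simp] = finite_card_polys_lt[THEN conjunct1]
  and card_polys_lt = finite_card_polys_lt[THEN conjunct2]

lemma mem_polys_lt_iff: "p \<in> polys_lt N \<longleftrightarrow> p = 0 \<or> degree p < N"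
proof (cases "p = 0")
  case False
  then show ?thesis
    by (auto simp: polys_lt_def coeff_eq_0 not_le[symmetric] dest: spec[of _ "degree p"])
qed (simp add: polys_lt_def)

lemma monics_eq: "monics m = (\<lambda>p. monom 1 m + p) ` polys_lt m"
proof (intro equalityI subsetI)
  fix p :: "'a poly" assume "p \<in> monics m"
  then have "p - monom 1 m \<in> polys_lt m"
    by (auto simp: monics_def polys_lt_def coeff_eq_0)
  then show "p \<in> (\<lambda>p. monom 1 m + p) ` polys_lt m"
    by (intro image_eqI[of _ _ "p - monom 1 m"]) auto
next
  fix p :: "'a poly" assume "p \<in> (\<lambda>p. monom 1 m + p) ` polys_lt m"
  then obtain r where r: "p = monom 1 m + r" "r \<in> polys_lt m" by blast
  have c: "coeff p i = (if i = m then 1 else if i > m then 0 else coeff r i)" for i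
    using r by (auto simp: polys_lt_def)
  then have "degree p = m"
    by (intro antisym degree_le le_degree) auto
  then show "p \<in> monics m" using c by (simp add: monics_def)
qed

lemma finite_monics [simp]: "finite (monics m)"
  by (simp add: monics_eq)

lemma card_monics: "card (monics m :: 'a::{finite,field} poly set) = CARD('a) ^ m"
  unfolding monics_eq by (subst card_image) (auto simp: inj_on_def card_polys_lt)

lemma countable_UNIV_poly: "countable (UNIV :: 'a::{finite,field} poly set)"
proof -
  have "p \<in> polys_lt (Suc (degree p))" for p :: "'a poly" by (simp add: mem_polys_lt_iff)
  then have "UNIV = (\<Union>N. polys_lt N :: 'a poly set)" by blast
  moreover have "countable (\<Union>N. polys_lt N :: 'a poly set)" 
    by (intro countable_UN countable_finite finite_polys_lt countableI_type)
  ultimately show ?thesis by simp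
qed

text \<open>The polynomials \<open>S\<close> with \<open>Q dvd S * R\<close> form an ideal containing \<open>P\<close> and \<open>Q\<close>, hence a
  generator of it is a unit. (There is no \<open>gcd\<close> on \<open>'a poly\<close> under the sort \<open>{finite,field}\<close>.)\<close>

lemma coprime_dvd_mult_poly:
  fixes P Q R :: "'a::field poly"
  assumes "coprime P Q" "Q dvd P * R"
  shows "Q dvd R"
proof (cases "P = 0 \<and> Q = 0")
  case True
  then show ?thesis using assms(1) by simp
next
  case False
  define I where "I S \<longleftrightarrow> Q dvd S * R" for S
  have "\<exists>S. S \<noteq> 0 \<and> I S" using False assms(2) by (auto simp: I_def)
  then obtain S where S: "S \<noteq> 0" "I S"
    and min: "\<And>S'. S' \<noteq> 0 \<Longrightarrow> I S' \<Longrightarrow> degree S \<le> degree S'"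
    using ex_has_least_nat[of "\<lambda>S. S \<noteq> 0 \<and> I S" _ degree] by metis
  have "S dvd S'" if "I S'" for S'
  proof -
    have "(S' - S * (S' div S)) * R = S' * R - (S * R) * (S' div S)"
      by (simp add: right_diff_distrib mult_ac)
    then have "(S' mod S) * R = S' * R - (S * R) * (S' div S)"
      by (simp only: minus_mult_div_eq_mod)
    then have "I (S' mod S)" using that S(2) by (simp add: I_def)
    then show ?thesis using min[of "S' mod S"] degree_mod_less[of S S'] S(1)
      by (metis dvd_eq_mod_eq_0 linorder_not_le)
  qed
  then have "S dvd P" "S dvd Q" using assms(2) by (auto simp: I_def)
  then have "is_unit S" using assms(1) by (rule coprime_common_divisor[rotated])
  then show ?thesis using S(2) unfolding I_def by (metis dvd_mult_unit_iff')
qed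

lemma reduced_denominator_unique:
  fixes P Q R S :: "'a::field poly"
  assumes "coprime P Q" "coprime R S" "P * S = R * Q"
  shows "Q dvd S" "S dvd Q"
  using assms coprime_dvd_mult_poly[of P Q S] coprime_dvd_mult_poly[of R S Q]
  by (metis dvd_triv_right)+

lemma dvd_same_lead_coeff_eq:
  fixes Q S :: "'a::field poly"
  assumes "Q dvd S" "S dvd Q" "lead_coeff Q = lead_coeff S"
  shows "Q = S"
proof (cases "S = 0")
  case False
  obtain T where T: "S = Q * T" using assms(1) by blast
  have "degree S \<le> degree Q" using assms False by (intro dvd_imp_degree_le) auto
  then have "degree T = 0" using T False by (auto simp: degree_mult_eq)
  then obtain c where "T = [:c:]" by (rule degree_eq_zeroE)
  then show ?thesis using T assms(3) False by (auto simp: lead_coeff_smult)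
qed (use assms in auto)

section \<open>Counting reduced fractions in a cylinder\<close>

text \<open>A set of points, not of pairs. The parameter \<open>m\<close> is the degree of the free
  factor \<open>Q\<close>; the denominator has degree \<open>degree Z + m\<close>. Fixing the
  leading coefficient of \<open>Q\<close> leaves one reduced representation for each point.\<close>

definition fracs :: "'a::{finite,field} poly \<Rightarrow> nat \<Rightarrow> 'a fls set" where
  "fracs Z m = {embed_poly P / embed_poly (Z * Q) | P Q. Q \<in> monics m \<and> coprime P (Z * Q)}"

lemma degree_mult_monic: "Z \<noteq> 0 \<Longrightarrow> Q \<in> monics m \<Longrightarrow> degree (Z * Q) = degree Z + m"
  by (subst degree_mult_eq) (auto simp: monics_def)

lemma monic_nonzero: "Q \<in> monics m \<Longrightarrow> Q \<noteq> 0"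
  by (auto simp: monics_def)

lemma fracs_separation:
  fixes Z :: "'a::{finite,field} poly"
  assumes "Z \<noteq> 0" "x \<in> fracs Z m" "y \<in> fracs Z n" "x \<in> cyl y k"
    and "2 * degree Z + m + n < k"
  shows "x = y" "m = n"
proof -
  obtain P Q where PQ: "x = embed_poly P / embed_poly (Z * Q)" "Q \<in> monics m" "coprime P (Z * Q)"
    using assms(2) by (auto simp: fracs_def)
  obtain R S where RS: "y = embed_poly R / embed_poly (Z * S)" "S \<in> monics n" "coprime R (Z * S)"
    using assms(3) by (auto simp: fracs_def)
  note nz = monic_nonzero[OF PQ(2)] monic_nonzero[OF RS(2)]
  show xy: "x = y"
    unfolding PQ(1) RS(1)
    using assms(1,4,5) PQ RS nz
    by (intro quotient_separation[where k = k]) (auto simp: degree_mult_monic)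
  then have "P * (Z * S) = R * (Z * Q)"
    using assms(1) nz unfolding PQ(1) RS(1) by (subst (asm) embed_quotient_eq_iff) auto
  from reduced_denominator_unique[OF PQ(3) RS(3) this]
  have "degree (Z * Q) = degree (Z * S)"
    using assms(1) nz by (intro antisym dvd_imp_degree_le) auto
  then show "m = n" using assms(1) PQ(2) RS(2) by (simp add: degree_mult_monic)
qed

text \<open>The ideal numerator is the polynomial part \<open>F\<close> of
  \<open>b * embed_poly (Z * Q)\<close>. Replacing it by the nearby polynomial
  \<open>1 + Z * (F div Z)\<close>, which is 1 modulo \<open>Z\<close>, alters only coefficients of
  degree less than \<open>degree Z\<close> or equal to 0. Adding \<open>Z * G\<close> alters only
  degrees below \<open>degree Z + m - k\<close>. Both changes are invisible at the precision of
  \<open>cyl b k\<close>.\<close>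

lemma ex_base_numerator:
  fixes Z :: "'a::{finite,field} poly"
  assumes "Z \<noteq> 0" "k \<le> m"
  shows "\<exists>H. \<forall>Q\<in>monics m. \<forall>G\<in>polys_lt (m - k).
    embed_poly (1 + Z * (H Q + G)) / embed_poly (Z * Q) \<in> cyl b k"
proof (intro bchoice ballI)
  fix Q :: "'a poly" assume Q: "Q \<in> monics m"
  obtain F where F: "\<forall>i\<le>0. embed_poly F $$ i = (b * embed_poly (Z * Q)) $$ i"
    using ex_polynomial_part by blast
  have "embed_poly (1 + Z * (F div Z + G)) / embed_poly (Z * Q) \<in> cyl b k"
    if G: "G \<in> polys_lt (m - k)" for G
  proof (rule quotient_mem_cylI)
    show "Z * Q \<noteq> 0" using assms(1) Q by (auto simp: monics_def)
  next
    fix i assume i: "i < int k - int (degree (Z * Q))"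
    then have i': "i < int k - int (degree Z) - int m" "i < 0"
      using assms Q by (simp_all add: degree_mult_monic)
    have "1 + Z * (F div Z + G) = F + (1 - F mod Z + Z * G)"
      by (simp add: distrib_left minus_mod_eq_mult_div[symmetric] algebra_simps)
    moreover have "coeff (1 - F mod Z + Z * G) (nat (- i)) = 0"
    proof -
      have "coeff (F mod Z) (nat (- i)) = 0"
        using degree_mod_less[OF assms(1), of F] i' assms(2)
        by (cases "F mod Z = 0") (auto intro!: coeff_eq_0)
      moreover have "coeff (Z * G) (nat (- i)) = 0"
        using G i' assms by (cases "G = 0") (auto simp: mem_polys_lt_iff degree_mult_eq intro!: coeff_eq_0)
      ultimately show ?thesis using i'(2) by (simp add: nat_eq_iff2 coeff_1)
    qed
    ultimately show "embed_poly (1 + Z * (F div Z + G)) $$ i = (b * embed_poly (Z * Q)) $$ i"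
      using F i'(2) by (simp add: nth_embed_poly)
  qed
  then show "\<exists>H. \<forall>G\<in>polys_lt (m - k).
      embed_poly (1 + Z * (H + G)) / embed_poly (Z * Q) \<in> cyl b k" by blast
qed

lemma card_monic_multiples:
  fixes D :: "'a::{finite,field} poly"
  assumes "D \<in> monics d" "d \<le> m"
  shows "card {Q \<in> monics m. D dvd Q} \<le> CARD('a) ^ (m - d)"
proof -
  have "{Q \<in> monics m. D dvd Q} \<subseteq> (\<lambda>E. D * E) ` monics (m - d)"
  proof
    fix Q assume Q: "Q \<in> {Q \<in> monics m. D dvd Q}"
    then obtain E where E: "Q = D * E" by blast
    have "E \<noteq> 0" "D \<noteq> 0" using Q E by (auto simp: monics_def)
    moreover have "lead_coeff E = 1"
      using Q assms(1) lead_coeff_mult[of D E] unfolding E by (auto simp: monics_def)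
    ultimately have "E \<in> monics (m - d)"
      using Q assms(1) unfolding E by (auto simp: monics_def degree_mult_eq)
    then show "Q \<in> (\<lambda>E. D * E) ` monics (m - d)" using E by blast
  qed
  then have "card {Q \<in> monics m. D dvd Q} \<le> card ((\<lambda>E. D * E) ` monics (m - d))"
    by (intro card_mono) auto
  also have "\<dots> \<le> card (monics (m - d) :: 'a poly set)" by (rule card_image_le) simp
  finally show ?thesis by (simp only: card_monics)
qed

lemma coprime_if_dvd_one_plus_mult:
  fixes D Z X :: "'a::field poly"
  assumes "D dvd 1 + Z * X"
  shows "coprime Z D"
proof (rule coprimeI)
  fix c assume "c dvd Z" "c dvd D"
  then have "c dvd 1 + Z * X" "c dvd Z * X" using assms by (auto intro: dvd_trans)
  then show "is_unit c" by (metis add_diff_cancel_right' dvd_diff)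
qed

text \<open>If such a \<open>G\<close> exists, \<open>D\<close> is coprime to \<open>Z\<close>, so
  the condition determines \<open>G\<close> modulo \<open>D\<close> and leaves only the quotient
  \<open>G div D\<close> free. For \<open>d > N\<close> the truncated exponent says that at most one
  \<open>G\<close> remains.\<close>

lemma card_divisible_shifts:
  fixes D :: "'a::{finite,field} poly"
  assumes "D \<in> monics d"
  shows "card {G \<in> polys_lt N. D dvd 1 + Z * (H + G)} \<le> CARD('a) ^ (N - d)"
proof -
  let ?S = "{G \<in> polys_lt N. D dvd 1 + Z * (H + G)}"
  have D: "D \<noteq> 0" "degree D = d" using assms by (auto simp: monics_def)
  have "inj_on (\<lambda>G. G div D) ?S"
  proof (rule inj_onI)
    fix G G' assume G: "G \<in> ?S" "G' \<in> ?S" "G div D = G' div D"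
    have "D dvd Z * (G - G')"
      using dvd_diff[of D "1 + Z * (H + G)" "1 + Z * (H + G')"] G by (simp add: algebra_simps)
    moreover have "coprime Z D" using G(1) coprime_if_dvd_one_plus_mult by blast
    ultimately have "D dvd G - G'" by (rule coprime_dvd_mult_poly[rotated])
    then have "G mod D = G' mod D" by (simp add: mod_eq_dvd_iff)
    then show "G = G'" using G(3) by (metis mult_div_mod_eq)
  qed
  moreover have "(\<lambda>G. G div D) ` ?S \<subseteq> polys_lt (N - d)"
  proof clarify
    fix G :: "'a poly" assume "G \<in> polys_lt N"
    moreover have "degree G = degree (G div D) + d" if "G div D \<noteq> 0"
    proof -
      have "degree (G mod D) < degree (D * (G div D)) \<or> G mod D = 0"
        using degree_mod_less[OF D(1), of G] D that by (auto simp: degree_mult_eq)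
      then have "degree (D * (G div D) + G mod D) = degree (D * (G div D))"
        using degree_add_eq_left by (metis add.right_neutral)
      then show ?thesis using D that by (simp add: degree_mult_eq)
    qed
    ultimately show "G div D \<in> polys_lt (N - d)"
      by (cases "G div D = 0") (auto simp: mem_polys_lt_iff)
  qed
  ultimately have "card ?S \<le> card (polys_lt (N - d) :: 'a poly set)"
    by (rule card_inj_on_le) simp
  then show ?thesis by (simp only: card_polys_lt)
qed

text \<open>The congruence \<open>1 + Z * _ \<equiv> 1 (mod Z)\<close> removes all common factors of degree 1, since \<open>Z\<close> is
  divisible by every linear polynomial. Starting the union bound at degree 2 is what makes it
  smaller than the number of all pairs even for \<open>q = 2\<close>.\<close>

lemma card_non_coprime_pairs:
  fixes Z :: "'a::{finite,field} poly"
  assumes "Z \<noteq> 0" and linear: "\<And>D. D \<in> monics 1 \<Longrightarrow> D dvd Z"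
  shows "card {(Q, G) \<in> monics m \<times> polys_lt N. \<not> coprime (1 + Z * (H Q + G)) (Z * Q)}
      \<le> (\<Sum>d\<in>{2..m}. CARD('a) ^ m * CARD('a) ^ (N - d))" (is "card ?B \<le> _")
proof -
  define B where "B D = (SIGMA Q:{Q \<in> monics m. D dvd Q}. {G \<in> polys_lt N. D dvd 1 + Z * (H Q + G)})"
    for D
  have fin: "finite (B D)" for D unfolding B_def by auto
  have "?B \<subseteq> (\<Union>d\<in>{2..m}. \<Union>D\<in>monics d. B D)"
  proof clarify
    fix Q G assume Q: "Q \<in> monics m" and G: "G \<in> polys_lt N"
      and nc: "\<not> coprime (1 + Z * (H Q + G)) (Z * Q)"
    obtain c where c: "c dvd 1 + Z * (H Q + G)" "c dvd Z * Q" "\<not> is_unit c"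
      using nc by (rule not_coprimeE)
    \<comment> \<open>Common factors are made monic, so that each degree contributes only
      \<open>CARD('a) ^ d\<close> candidates to the union bound.\<close>
    define D where "D = smult (inverse (lead_coeff c)) c"
    have "c \<noteq> 0" using c(2) assms(1) monic_nonzero[OF Q] by auto
    then have D: "D dvd 1 + Z * (H Q + G)" "D dvd Z * Q" "\<not> is_unit D" "lead_coeff D = 1" "D \<noteq> 0"
      using c by (auto simp: D_def smult_dvd_iff)
    \<comment> \<open>A divisor of a polynomial that is 1 modulo \<open>Z\<close> is coprime to
      \<open>Z\<close>; it therefore divides \<open>Q\<close>, which bounds its degree by
      \<open>m\<close>.\<close>
    have "D dvd Q"
      using coprime_dvd_mult_poly[OF coprime_if_dvd_one_plus_mult[OF D(1)] D(2)] .
    moreover from this have "degree D \<le> m"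
      using Q monic_nonzero[OF Q] by (auto simp: monics_def dvd_imp_degree_le)
    moreover have "degree D \<noteq> 1"
    proof
      assume "degree D = 1"
      then have "D dvd Z" using D(4) linear by (simp add: monics_def)
      then show False
        using D(1,3) by (metis add_diff_cancel_right' dvd_diff dvd_mult2)
    qed
    moreover have "degree D \<noteq> 0" using D(3,5) is_unit_iff_degree by blast
    ultimately show "(Q, G) \<in> (\<Union>d\<in>{2..m}. \<Union>D\<in>monics d. B D)"
      using Q G D(1,4) by (intro UN_I[of "degree D"] UN_I[of D]) (auto simp: B_def monics_def)
  qed
  then have "card ?B \<le> card (\<Union>d\<in>{2..m}. \<Union>D\<in>monics d. B D)"
    using fin by (intro card_mono) auto
  also have "\<dots> \<le> (\<Sum>d\<in>{2..m}. card (\<Union>D\<in>monics d. B D))"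
    by (rule card_UN_le) simp
  also have "\<dots> \<le> (\<Sum>d\<in>{2..m}. CARD('a) ^ m * CARD('a) ^ (N - d))"
  proof (rule sum_mono)
    fix d assume d: "d \<in> {2..m}"
    have B: "card (B D) \<le> CARD('a) ^ (m - d) * CARD('a) ^ (N - d)" if D: "D \<in> monics d" for D
    proof -
      have "card (B D) = (\<Sum>Q\<in>{Q \<in> monics m. D dvd Q}. card {G \<in> polys_lt N. D dvd 1 + Z * (H Q + G)})"
        unfolding B_def by (rule card_SigmaI) auto
      also have "\<dots> \<le> (\<Sum>Q\<in>{Q \<in> monics m. D dvd Q}. CARD('a) ^ (N - d))"
        by (intro sum_mono card_divisible_shifts D)
      also have "\<dots> = card {Q \<in> monics m. D dvd Q} * CARD('a) ^ (N - d)" by simp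
      also have "\<dots> \<le> CARD('a) ^ (m - d) * CARD('a) ^ (N - d)"
        using d D by (intro mult_right_mono card_monic_multiples) auto
      finally show ?thesis .
    qed
    have "card (\<Union>D\<in>monics d. B D) \<le> (\<Sum>D\<in>(monics d :: 'a poly set). card (B D))"
      by (rule card_UN_le) simp
    also have "\<dots> \<le> (\<Sum>D\<in>(monics d :: 'a poly set). CARD('a) ^ (m - d) * CARD('a) ^ (N - d))"
      by (intro sum_mono B)
    \<comment> \<open>The \<open>CARD('a) ^ d\<close> choices of \<open>D\<close> cancel the saving
      in the number of multiples \<open>Q\<close>; the saving in the number of shifts
      \<open>G\<close> survives.\<close>
    also have "\<dots> = CARD('a) ^ m * CARD('a) ^ (N - d)"
      using d by (simp add: card_monics mult.assoc[symmetric] power_add[symmetric])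
    finally show "card (\<Union>D\<in>monics d. B D) \<le> CARD('a) ^ m * CARD('a) ^ (N - d)" .
  qed
  finally show ?thesis .
qed

text \<open>The terms with \<open>d \<le> N\<close> are dominated by a geometric series with ratio
  1/2, whose tail from \<open>d = 2\<close> on is 1/2. Each term with \<open>d > N\<close> equals 1
  because of truncated subtraction, which accounts for the summand \<open>m\<close>.\<close>

lemma sum_truncated_powers_le:
  fixes q :: nat
  assumes "2 \<le> q"
  shows "real (\<Sum>d\<in>{2..m}. q ^ (N - d)) \<le> real q ^ N / 2 + real m"
proof -
  have "real q ^ (N - d) \<le> real q ^ N * (1 / 2) ^ d + 1" for d
  proof (cases "d \<le> N")
    case True
    have "real q ^ (N - d) * 2 ^ d \<le> real q ^ (N - d) * real q ^ d"
      using assms by (intro mult_left_mono power_mono) auto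
    also have "\<dots> = real q ^ N" using True by (simp flip: power_add)
    finally have "real q ^ (N - d) \<le> real q ^ N * (1 / 2) ^ d" by (simp add: field_simps)
    then show ?thesis by simp
  qed simp
  then have "real (\<Sum>d\<in>{2..m}. q ^ (N - d)) \<le> (\<Sum>d\<in>{2..m}. real q ^ N * (1 / 2) ^ d + 1)"
    by (simp add: sum_mono)
  also have "\<dots> = real q ^ N * (\<Sum>d\<in>{2..m}. (1 / 2) ^ d) + real (m - 1)"
    by (simp add: sum.distrib sum_distrib_left)
  also have "\<dots> \<le> real q ^ N * (1 / 2) + real m"
  proof (intro add_mono mult_left_mono)
    show "(\<Sum>d\<in>{2..m}. (1 / 2) ^ d) \<le> (1 / 2 :: real)"
    proof -
      have sum_eq: "(\<Sum>d\<in>{2..Suc j}. (1 / 2) ^ d) = (1 / 2 - (1 / 2) ^ Suc j :: real)" for j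
        by (induction j) auto
      show ?thesis
      proof (cases m)
        case (Suc j)
        show ?thesis unfolding Suc sum_eq by simp
      qed simp
    qed
  qed auto
  finally show ?thesis by simp
qed

text \<open>Points of \<open>fracs Z m\<close> are separated at depth
  \<open>2 * (degree Z + m) + 1\<close>, one more than the degree of the product of two
  denominators. The condition on \<open>k\<close> keeps the subtraction genuine.\<close>

lemma fracs_finite_card_le:
  fixes Z :: "'a::{finite,field} poly"
  assumes "Z \<noteq> 0" "k \<le> 2 * (degree Z + m) + 1"
  shows "finite (fracs Z m \<inter> cyl b k)"
    and "card (fracs Z m \<inter> cyl b k) \<le> CARD('a) ^ (2 * (degree Z + m) + 1 - k)"
proof -
  have "x = y" if "x \<in> fracs Z m \<inter> cyl b k" "y \<in> fracs Z m \<inter> cyl b k"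
    "x \<in> cyl y (k + (2 * (degree Z + m) + 1 - k))" for x y
    using that assms fracs_separation(1)[of Z x m y m "2 * (degree Z + m) + 1"] by auto
  note * = card_separated_subset_cyl[where b = b and k = k and S = "fracs Z m \<inter> cyl b k"
        and n = "2 * (degree Z + m) + 1 - k", OF _ this]
  show "finite (fracs Z m \<inter> cyl b k)" by (rule *) auto
  show "card (fracs Z m \<inter> cyl b k) \<le> CARD('a) ^ (2 * (degree Z + m) + 1 - k)"
    by (rule *) auto
qed

text \<open>The fraction 1/4 is what remains after 1/2 of all pairs is given up to the geometric
  series of common factors and 1/4 to the linear error, which
  \<open>4 * m \<le> CARD('a) ^ (m - k)\<close> controls.\<close>

lemma card_fracs_ge:
  fixes Z :: "'a::{finite,field} poly"
  assumes "Z \<noteq> 0" and linear: "\<And>D. D \<in> monics 1 \<Longrightarrow> D dvd Z"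
    and "k \<le> m" "4 * m \<le> CARD('a) ^ (m - k)"
  shows "real CARD('a) ^ (m + (m - k)) / 4 \<le> card (fracs Z m \<inter> cyl b k)"
proof -
  let ?q = "CARD('a)" and ?N = "m - k"
  obtain H where H: "\<And>Q G. Q \<in> monics m \<Longrightarrow> G \<in> polys_lt ?N \<Longrightarrow>
      embed_poly (1 + Z * (H Q + G)) / embed_poly (Z * Q) \<in> cyl b k"
    using ex_base_numerator[OF assms(1,3), of b] by blast
  let ?T = "(monics m :: 'a poly set) \<times> (polys_lt ?N :: 'a poly set)"
  let ?B = "{(Q, G) \<in> ?T. \<not> coprime (1 + Z * (H Q + G)) (Z * Q)}"
  let ?F = "\<lambda>(Q, G). embed_poly (1 + Z * (H Q + G)) / embed_poly (Z * Q)"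
  \<comment> \<open>The base numerator \<open>H Q\<close> depends on \<open>Q\<close>, so
    \<open>Q = Q'\<close> has to come first: reduced denominators of equal fractions are associated,
    and their leading coefficients agree.\<close>
  have inj: "inj_on ?F (?T - ?B)"
  proof (rule inj_onI)
    fix x y assume xy: "x \<in> ?T - ?B" "y \<in> ?T - ?B" "?F x = ?F y"
    obtain Q G Q' G' where [simp]: "x = (Q, G)" "y = (Q', G')" by (cases x, cases y)
    have *: "Q \<in> monics m" "Q' \<in> monics m"
      "coprime (1 + Z * (H Q + G)) (Z * Q)" "coprime (1 + Z * (H Q' + G')) (Z * Q')"
      "embed_poly (1 + Z * (H Q + G)) / embed_poly (Z * Q) =
       embed_poly (1 + Z * (H Q' + G')) / embed_poly (Z * Q')"
      using xy by auto
    note nz = assms(1) monic_nonzero[OF *(1)] monic_nonzero[OF *(2)]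
    have eq: "(1 + Z * (H Q + G)) * (Z * Q') = (1 + Z * (H Q' + G')) * (Z * Q)"
      using *(5) nz by (subst (asm) embed_quotient_eq_iff) auto
    from reduced_denominator_unique[OF *(3,4) eq]
    have "Z * Q = Z * Q'"
      using * by (intro dvd_same_lead_coeff_eq) (auto simp: lead_coeff_mult monics_def)
    then show "x = y" using eq nz by auto
  qed
  have sub: "?F ` (?T - ?B) \<subseteq> fracs Z m \<inter> cyl b k"
    using H by (auto simp: fracs_def)
  have "real (card ?B) \<le> real (\<Sum>d\<in>{2..m}. ?q ^ m * ?q ^ (?N - d))"
    using card_non_coprime_pairs[OF assms(1) linear, of m ?N H] by (simp only: of_nat_le_iff)
  also have "\<dots> = real ?q ^ m * real (\<Sum>d\<in>{2..m}. ?q ^ (?N - d))"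
    by (simp add: sum_distrib_left)
  also have "\<dots> \<le> real ?q ^ m * (real ?q ^ ?N / 2 + real m)"
    by (intro mult_left_mono sum_truncated_powers_le card_field_ge_2) auto
  also have "\<dots> \<le> real ?q ^ m * (real ?q ^ ?N / 2 + real ?q ^ ?N / 4)"
  proof -
    have "real (4 * m) \<le> real (?q ^ ?N)" using assms(4) by (simp only: of_nat_le_iff)
    then show ?thesis by (intro mult_left_mono) auto
  qed
  finally have B: "real (card ?B) \<le> real ?q ^ m * (real ?q ^ ?N / 2 + real ?q ^ ?N / 4)" .
  have "real ?q ^ (m + ?N) / 4 = real ?q ^ m * real ?q ^ ?N - real ?q ^ m * (real ?q ^ ?N / 2 + real ?q ^ ?N / 4)"
    by (simp add: power_add field_simps)
  also have "\<dots> \<le> real (card ?T) - real (card ?B)"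
    using B by (simp add: card_cartesian_product card_monics card_polys_lt)
  also have "\<dots> \<le> real (card (?T - ?B))"
  proof -
    have BT: "?B \<subseteq> ?T" and fin: "finite ?T" by auto
    have "card (?T - ?B) = card ?T - card ?B"
      by (rule card_Diff_subset[OF finite_subset[OF BT fin] BT])
    moreover have "card ?B \<le> card ?T" by (rule card_mono[OF fin BT])
    ultimately show ?thesis by linarith
  qed
  also have "\<dots> = real (card (?F ` (?T - ?B)))"
    using card_image[OF inj] by simp
  also have "\<dots> \<le> real (card (fracs Z m \<inter> cyl b k))"
    using sub fracs_finite_card_le(1)[of Z k m b] assms by (intro of_nat_mono card_mono) auto
  finally show ?thesis .
qed

lemma eventually_linear_le_power:
  assumes "2 \<le> (q::nat)"
  shows "\<forall>\<^sub>F m in sequentially. k \<le> m \<and> 4 * m \<le> q ^ (m - k)"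
proof -
  have "(\<lambda>m. real m * (1 / real q) ^ m) \<longlonglongrightarrow> 0"
    using assms by (intro powser_times_n_limit_0) auto
  then have "\<forall>\<^sub>F m in sequentially. real m * (1 / real q) ^ m < 1 / (4 * real q ^ k)"
    using assms by (intro order_tendstoD) auto
  then show ?thesis using eventually_ge_at_top[of k]
  proof eventually_elim
    case (elim m)
    have "real (4 * m) * real q ^ k \<le> real q ^ m"
      using elim(1) assms by (simp add: field_simps power_one_over)
    also have "\<dots> = real (q ^ (m - k)) * real q ^ k"
      using elim(2) by (simp flip: power_add)
    finally show ?case using elim(2) assms by (simp del: of_nat_power of_nat_mult)
  qed
qed

section \<open>Measure estimates\<close>

context haar
begin

lemma Int_cyl_fmeasurable: "A \<in> sets M \<Longrightarrow> A \<inter> cyl b k \<in> fmeasurable M"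
  by (rule fmeasurableI2[OF fmeasurable_cyl]) auto

lemma measure_UN_cyl_le:
  assumes "finite S"
  shows "measure M (\<Union>x\<in>S. cyl x k) \<le> card S * (measure M (cyl 0 0) / real CARD('a) ^ k)"
proof -
  have "measure M (\<Union>x\<in>S. cyl x k) \<le> (\<Sum>x\<in>S. measure M (cyl x k))"
    using assms by (rule measure_UNION_le) simp
  also have "\<dots> = (\<Sum>x\<in>S. measure M (cyl 0 0) / real CARD('a) ^ k)"
    by (rule sum.cong[OF refl measure_cyl])
  finally show ?thesis by simp
qed

lemma measure_UN_separated_cyl:
  assumes "finite S" and sep: "\<And>x y. x \<in> S \<Longrightarrow> y \<in> S \<Longrightarrow> x \<in> cyl y k \<Longrightarrow> x = y"
  shows "measure M (\<Union>x\<in>S. cyl x k) = card S * (measure M (cyl 0 0) / real CARD('a) ^ k)"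
proof -
  have "disjoint_family_on (\<lambda>x. cyl x k) S"
    unfolding disjoint_family_on_def using sep cyl_eq mem_cyl_self by (metis disjoint_iff)
  then have "measure M (\<Union>x\<in>S. cyl x k) = (\<Sum>x\<in>S. measure M (cyl x k))"
    using assms(1) fmeasurableD2[OF fmeasurable_cyl] by (intro measure_finite_Union) auto
  also have "\<dots> = (\<Sum>x\<in>S. measure M (cyl 0 0) / real CARD('a) ^ k)"
    by (rule sum.cong[OF refl measure_cyl])
  finally show ?thesis by simp
qed

text \<open>Unit cylinders around polynomials form a countable cover by sets of finite measure,
  since every series has a polynomial part.\<close>

lemma AE_from_unit_cyls:
  assumes "\<And>b. AE f in M. f \<in> cyl b 0 \<longrightarrow> R f"
  shows "AE f in M. R f"
proof -
  have "AE f in M. \<forall>P\<in>UNIV. f \<in> cyl (embed_poly P) 0 \<longrightarrow> R f"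
    using assms by (intro AE_ball_countable' countable_UNIV_poly)
  moreover have "\<exists>P. f \<in> cyl (embed_poly P) 0" for f :: "'a fls"
    using ex_polynomial_part[of f] by (simp add: cyl_def) (metis less_imp_le)
  ultimately show ?thesis by (auto elim!: eventually_mono)
qed

text \<open>A unit cylinder contains at most \<open>CARD('a) ^ (2 * n + 1)\<close> such fractions,
  and the neighbourhood depth \<open>2 * n + s n\<close> leaves a constant times
  \<open>1 / CARD('a) ^ s n\<close>. Fractions are collected as points, so non-reduced
  representations do not inflate the count.\<close>

lemma AE_eventually_not_approximable:
  assumes "summable (\<lambda>n. 1 / real CARD('a) ^ s n)"
  shows "AE f in M. \<forall>\<^sub>F n in sequentially. \<forall>P Q. Q \<noteq> 0 \<longrightarrow> degree Q = n \<longrightarrow>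
    f \<notin> cyl (embed_poly P / embed_poly Q) (2 * n + s n)"
proof (rule AE_from_unit_cyls)
  fix b :: "'a fls"
  let ?q = "real CARD('a)"
  define F where "F n = {embed_poly P / embed_poly Q | P (Q :: 'a poly). Q \<noteq> 0 \<and> degree Q = n}" for n
  define A where "A n = (\<Union>x\<in>F n. cyl x (2 * n + s n)) \<inter> cyl b 0" for n
  have sep: "x = y" if xy: "x \<in> F n \<inter> cyl b 0" "y \<in> F n \<inter> cyl b 0" "x \<in> cyl y (0 + (2 * n + 1))" for x y n
  proof -
    obtain P Q where PQ: "x = embed_poly P / embed_poly Q" "Q \<noteq> 0" "degree Q = n"
      using xy(1) by (auto simp: F_def)
    obtain R S where RS: "y = embed_poly R / embed_poly S" "S \<noteq> 0" "degree S = n"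
      using xy(2) by (auto simp: F_def)
    show ?thesis
      using xy(3) PQ(2,3) RS(2,3) unfolding PQ(1) RS(1)
      by (intro quotient_separation[where k = "2 * n + 1"]) auto
  qed
  have F: "finite (F n \<inter> cyl b 0)" "card (F n \<inter> cyl b 0) \<le> CARD('a) ^ (2 * n + 1)" for n
    using card_separated_subset_cyl[OF Int_lower2, of "F n" b 0 "2 * n + 1"] sep by blast+
  have sub: "A n \<subseteq> (\<Union>x\<in>F n \<inter> cyl b 0. cyl x (2 * n + s n))" for n
  proof
    fix f assume "f \<in> A n"
    then obtain x where x: "x \<in> F n" "f \<in> cyl x (2 * n + s n)" "f \<in> cyl b 0" by (auto simp: A_def)
    then have "x \<in> cyl b 0" using cyl_mono[of 0 "2 * n + s n" x] cyl_eq cyl_sym by blast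
    then show "f \<in> (\<Union>x\<in>F n \<inter> cyl b 0. cyl x (2 * n + s n))" using x by blast
  qed
  have A_sets: "A n \<in> sets M" for n
    unfolding A_def by (intro open_in_sets open_Int open_UN ballI open_cyl)
  have "summable (\<lambda>n. measure M (A n))"
  proof (rule summable_comparison_test[OF exI[of _ 0]], intro allI impI)
    fix n
    have "measure M (A n) \<le> measure M (\<Union>x\<in>F n \<inter> cyl b 0. cyl x (2 * n + s n))"
      using F(1) by (intro measure_mono_fmeasurable sub A_sets fmeasurable.finite_UN) auto
    also have "\<dots> \<le> card (F n \<inter> cyl b 0) * (measure M (cyl 0 0) / ?q ^ (2 * n + s n))"
      using F(1) by (rule measure_UN_cyl_le)
    also have "\<dots> \<le> real (CARD('a) ^ (2 * n + 1)) * (measure M (cyl 0 0) / ?q ^ (2 * n + s n))"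
      using F(2) by (intro mult_right_mono of_nat_mono) auto
    also have "\<dots> = ?q * measure M (cyl 0 0) * (1 / ?q ^ s n)"
      by (simp add: power_add)
    finally show "norm (measure M (A n)) \<le> ?q * measure M (cyl 0 0) * (1 / ?q ^ s n)" by simp
  qed (intro summable_mult assms)
  moreover have "emeasure M (A n) < \<infinity>" for n
    using A_sets[of n] fmeasurableI2[OF fmeasurable_cyl[of b 0], of "A n"]
    by (auto simp: A_def fmeasurable_def)
  ultimately have "AE f in M. \<forall>\<^sub>F n in sequentially. f \<in> space M - A n"
    using A_sets by (intro borel_cantelli_AE1)
  then show "AE f in M. f \<in> cyl b 0 \<longrightarrow> (\<forall>\<^sub>F n in sequentially. \<forall>P Q. Q \<noteq> 0 \<longrightarrow> degree Q = n \<longrightarrow>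
      f \<notin> cyl (embed_poly P / embed_poly Q) (2 * n + s n))"
  proof eventually_elim
    case (elim f)
    show ?case
    proof
      assume "f \<in> cyl b 0"
      with elim show "\<forall>\<^sub>F n in sequentially. \<forall>P Q. Q \<noteq> 0 \<longrightarrow> degree Q = n \<longrightarrow>
          f \<notin> cyl (embed_poly P / embed_poly Q) (2 * n + s n)"
        by (auto elim!: eventually_mono simp: A_def F_def)
    qed
  qed
qed

text \<open>Bonferroni's inequality built up one set at a time: with \<open>S\<close> the sum so
  far, \<open>F n\<close> adds at least \<open>c * w n * \<beta>\<close> and overlaps the earlier
  union in at most \<open>K * w n * S * \<beta>\<close>, which is less than the growth of the square
  allows for.\<close>

lemma measure_UN_ge_quadratic:
  fixes F :: "nat \<Rightarrow> 'a fls set" and w :: "nat \<Rightarrow> real"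
  assumes F: "\<And>i. F i \<in> sets M"
    and w: "\<And>i. 0 \<le> w i" and "0 \<le> K" "a \<le> n"
    and lower: "\<And>i. a \<le> i \<Longrightarrow> c * w i * \<beta> \<le> measure M (F i \<inter> cyl b k)"
    and upper: "\<And>i j. a \<le> i \<Longrightarrow> i < j \<Longrightarrow> measure M (F i \<inter> F j \<inter> cyl b k) \<le> K * w i * w j * \<beta>"
    and "0 \<le> \<beta>"
  shows "(c * (\<Sum>i\<in>{a..<n}. w i) - K * (\<Sum>i\<in>{a..<n}. w i)\<^sup>2) * \<beta>
    \<le> measure M ((\<Union>i\<in>{a..<n}. F i) \<inter> cyl b k)"
  using \<open>a \<le> n\<close>
proof (induction n rule: dec_induct)
  case base
  show ?case by simp
next
  case (step n)
  define S where "S = (\<Sum>i\<in>{a..<n}. w i)"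
  have "0 \<le> S" unfolding S_def by (intro sum_nonneg w)
  let ?U = "(\<Union>i\<in>{a..<n}. F i) \<inter> cyl b k" and ?V = "F n \<inter> cyl b k"
  have UV: "?U \<in> fmeasurable M" "?V \<in> fmeasurable M"
    using F by (auto intro!: Int_cyl_fmeasurable sets.finite_UN)
  have "measure M (?U \<inter> ?V) \<le> measure M (\<Union>i\<in>{a..<n}. F i \<inter> F n \<inter> cyl b k)"
    using F by (intro measure_mono_fmeasurable fmeasurable.finite_UN Int_cyl_fmeasurable)
      (auto intro!: sets.Int sets.finite_UN)
  also have "\<dots> \<le> (\<Sum>i\<in>{a..<n}. measure M (F i \<inter> F n \<inter> cyl b k))"
    using F by (intro measure_UNION_le) auto
  also have "\<dots> \<le> (\<Sum>i\<in>{a..<n}. w i * (K * w n * \<beta>))"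
    using upper[of _ n] by (intro sum_mono) (auto simp: mult_ac)
  also have "\<dots> = K * w n * S * \<beta>" by (simp add: S_def sum_distrib_left sum_distrib_right mult_ac)
  finally have inter: "measure M (?U \<inter> ?V) \<le> K * w n * S * \<beta>" .
  have "(c * (S + w n) - K * (S + w n)\<^sup>2) * \<beta>
      \<le> (c * S - K * S\<^sup>2) * \<beta> + c * w n * \<beta> - K * w n * S * \<beta>"
  proof -
    have "0 \<le> K * (w n)\<^sup>2 * \<beta> + K * w n * S * \<beta>" using assms(3,7) w[of n] \<open>0 \<le> S\<close> by simp
    then show ?thesis by (simp add: power2_eq_square algebra_simps)
  qed
  also have "\<dots> \<le> measure M ?U + measure M ?V - measure M (?U \<inter> ?V)"
    using step.IH lower[of n] step.hyps inter by (simp add: S_def)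
  also have "\<dots> = measure M (?U \<union> ?V)"
    using UV by (simp add: measure_Un3)
  also have "?U \<union> ?V = (\<Union>i\<in>{a..<Suc n}. F i) \<inter> cyl b k"
    using step.hyps by (auto simp: less_Suc_eq)
  finally show ?case using step.hyps by (simp add: S_def)
qed

text \<open>Only the indices below which the sum of the \<open>w i\<close> first exceeds \<open>c / (4 * K)\<close> are used: there
  the quadratic term of Bonferroni's inequality does not absorb the linear one.\<close>

lemma measure_UN_ge_if_quasi_independent:
  fixes F :: "nat \<Rightarrow> 'a fls set" and w :: "nat \<Rightarrow> real"
  assumes F: "\<And>i. F i \<in> sets M"
    and w: "\<And>i. 0 \<le> w i" "\<And>i. w i \<le> c / (4 * K)" and nosum: "\<not> summable w"
    and "0 < K" "0 < c" "0 \<le> \<beta>"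
    and lower: "\<And>i. a \<le> i \<Longrightarrow> c * w i * \<beta> \<le> measure M (F i \<inter> cyl b k)"
    and upper: "\<And>i j. a \<le> i \<Longrightarrow> i < j \<Longrightarrow> measure M (F i \<inter> F j \<inter> cyl b k) \<le> K * w i * w j * \<beta>"
  shows "c\<^sup>2 / (8 * K) * \<beta> \<le> measure M ((\<Union>i\<in>{a..}. F i) \<inter> cyl b k)"
proof -
  define S where "S n = (\<Sum>i\<in>{a..<n}. w i)" for n
  have "\<exists>n. c / (4 * K) \<le> S n"
  proof (rule ccontr)
    assume *: "\<not> ?thesis"
    have "summable (\<lambda>i. w (i + a))"
    proof (rule summableI_nonneg_bounded)
      fix n
      have "(\<Sum>i<n. w (i + a)) = S (n + a)"
        unfolding S_def using sum.shift_bounds_nat_ivl[of w 0 a n]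
        by (simp add: atLeast0LessThan)
      then show "(\<Sum>i<n. w (i + a)) \<le> c / (4 * K)" using * by (metis linorder_not_le less_imp_le)
    qed (rule w)
    then show False using nosum by (simp add: summable_iff_shift)
  qed
  then obtain n where n: "c / (4 * K) \<le> S n" "\<And>m. m < n \<Longrightarrow> S m < c / (4 * K)"
    using exists_least_iff[of "\<lambda>n. c / (4 * K) \<le> S n"] by (metis linorder_not_le)
  have "a < n"
  proof (rule ccontr)
    assume "\<not> ?thesis"
    then have "S n = 0" by (simp add: S_def)
    then show False using n(1) \<open>0 < K\<close> \<open>0 < c\<close> by (simp add: field_simps)
  qed
  then obtain m where m: "n = Suc m" "a \<le> m" by (cases n) auto
  then have "S n = S m + w m" by (simp add: S_def)
  \<comment> \<open>Minimality of \<open>n\<close> bounds \<open>S m\<close>, and the cap on the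
    weights keeps the last summand from overshooting. On the resulting range from
    \<open>c / (4 * K)\<close> to \<open>c / (2 * K)\<close>, the product
    \<open>S n * (c - K * S n)\<close> is at least \<open>c / (4 * K) * (c / 2)\<close>, the origin
    of the 8.\<close>
  then have "S n \<le> c / (2 * K)" using n(2)[of m] w(2)[of m] m(1) by (simp add: field_simps)
  then have "K * S n \<le> c / 2" using \<open>0 < K\<close> by (simp add: field_simps)
  moreover have "0 \<le> c / (4 * K)" using \<open>0 < K\<close> \<open>0 < c\<close> by simp
  then have "0 \<le> S n" using n(1) by linarith
  ultimately have "c / (4 * K) * (c / 2) \<le> S n * (c - K * S n)"
    using n(1) \<open>0 < c\<close> by (intro mult_mono) auto
  then have "c\<^sup>2 / (8 * K) \<le> c * S n - K * (S n)\<^sup>2"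
    by (simp add: power2_eq_square algebra_simps)
  then have "c\<^sup>2 / (8 * K) * \<beta> \<le> (c * S n - K * (S n)\<^sup>2) * \<beta>"
    using \<open>0 \<le> \<beta>\<close> by (rule mult_right_mono)
  also have "\<dots> \<le> measure M ((\<Union>i\<in>{a..<n}. F i) \<inter> cyl b k)"
    unfolding S_def using assms \<open>a < n\<close> by (intro measure_UN_ge_quadratic) auto
  also have "\<dots> \<le> measure M ((\<Union>i\<in>{a..}. F i) \<inter> cyl b k)"
    using F by (intro measure_mono_fmeasurable Int_cyl_fmeasurable)
      (auto intro!: sets.Int sets.finite_UN sets.countable_UN')
  finally show ?thesis .
qed

text \<open>As \<open>U\<close> is open, its complement \<open>C\<close> in a unit cylinder is the
  decreasing intersection of its cylinder neighbourhoods \<open>N k\<close>. Each cylinder making up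
  \<open>N k\<close> loses the proportion \<kappa> to \<open>U\<close>, and letting \<open>k\<close>
  grow gives \<open>measure M C \<le> (1 - \<kappa>) * measure M C\<close>. No density points are
  needed.\<close>

lemma AE_mem_if_uniform_density:
  assumes "open U" "0 < \<kappa>"
    and dens: "\<And>b k. \<kappa> * measure M (cyl b k) \<le> measure M (U \<inter> cyl b k)"
  shows "AE f in M. f \<in> U"
proof (rule AE_from_unit_cyls)
  fix b :: "'a fls"
  define C where "C = cyl b 0 - U"
  define N where "N k = (\<Union>x\<in>C. cyl x k)" for k
  have U: "U \<in> sets M" using assms(1) by (rule open_in_sets)
  have N_sets: "N k \<in> sets M" for k
    unfolding N_def by (intro open_in_sets open_UN ballI open_cyl)
  have N_sub: "N k \<subseteq> cyl b 0" for k
    using cyl_subset[of _ b 0 k] by (auto simp: N_def C_def)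
  then have N_fm: "N k \<in> fmeasurable M" for k
    by (rule fmeasurableI2[OF fmeasurable_cyl _ N_sets])
  have C_eq: "C = (\<Inter>k. N k)"
  proof (intro equalityI subsetI)
    fix f assume f: "f \<in> (\<Inter>k. N k)"
    have "f \<notin> U"
    proof
      assume "f \<in> U"
      then obtain r where r: "r > 0" "{y. dist y f < r} \<subseteq> U"
        using assms(1) unfolding open_fls_def by blast
      then obtain m where m: "1 / 2 ^ m < r"
        using real_arch_pow_inv[of r "1/2"] by (auto simp: power_one_over)
      obtain x where "x \<in> C" "f \<in> cyl x m" using f by (auto simp: N_def)
      then have "x \<in> cyl f m" "x \<notin> U" using cyl_sym by (auto simp: C_def)
      moreover from this have "x \<in> {y. dist y f < r}" using mem_cyl_imp_dist_le[of x f m] m by simp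
      ultimately show False using r(2) by blast
    qed
    then show "f \<in> C" using f N_sub by (auto simp: C_def)
  next
    fix f assume "f \<in> C"
    then show "f \<in> (\<Inter>k. N k)" unfolding N_def using mem_cyl_self by blast
  qed
  have C_sets: "C \<in> sets M" using U by (auto simp: C_def)
  have le: "measure M C \<le> (1 - \<kappa>) * measure M (N k)" for k
  proof -
    \<comment> \<open>Indexed by the cylinders themselves, not by their centres: distinct members
      are then disjoint, and there are finitely many.\<close>
    let ?D = "(\<lambda>x. cyl x k) ` C"
    obtain K where K: "finite K" "cyl b 0 = (\<Union>x\<in>K. cyl x (0 + k))"
      by (rule cyl_finite_cover)
    have "?D \<subseteq> (\<lambda>x. cyl x k) ` K"
    proof clarify
      fix x assume "x \<in> C"
      then obtain y where "y \<in> K" "x \<in> cyl y k" using K(2) by (auto simp: C_def)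
      then show "cyl x k \<in> (\<lambda>x. cyl x k) ` K" using cyl_eq by blast
    qed
    then have fin: "finite ?D" using K(1) by (meson finite_imageI finite_subset)
    have disj: "disjoint_family_on (\<lambda>X. X \<inter> V) ?D" for V
      unfolding disjoint_family_on_def using cyl_eq by blast
    have sum: "measure M (N k \<inter> V) = (\<Sum>X\<in>?D. measure M (X \<inter> V))" if "V \<in> sets M" for V
    proof -
      have fm: "X \<inter> V \<in> fmeasurable M" if "X \<in> ?D" for X
        using that Int_cyl_fmeasurable[OF \<open>V \<in> sets M\<close>] by (auto simp: Int_commute)
      have "N k \<inter> V = (\<Union>X\<in>?D. X \<inter> V)" by (auto simp: N_def)
      also have "measure M \<dots> = (\<Sum>X\<in>?D. measure M (X \<inter> V))"
      proof (rule measure_finite_Union[OF fin _ disj])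
        show "(\<lambda>X. X \<inter> V) ` ?D \<subseteq> sets M" using fmeasurableD[OF fm] by (rule image_subsetI)
      qed (use fmeasurableD2[OF fm] in \<open>simp only: infinity_ennreal_def not_False_eq_True\<close>)
      finally show ?thesis .
    qed
    have "\<kappa> * measure M (N k) = (\<Sum>X\<in>?D. \<kappa> * measure M X)"
      using sum[of UNIV] space_M sets.top[of M] by (simp add: sum_distrib_left)
    also have "\<dots> \<le> (\<Sum>X\<in>?D. measure M (X \<inter> U))"
      using dens by (intro sum_mono) (auto simp: Int_commute)
    also have "\<dots> = measure M (N k \<inter> U)" using sum[OF U] by simp
    finally have ge: "\<kappa> * measure M (N k) \<le> measure M (N k \<inter> U)" .
    have fm: "N k - U \<in> fmeasurable M" "N k \<inter> U \<in> fmeasurable M"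
      using N_sets U by (auto intro!: fmeasurableI2[OF N_fm[of k]])
    have "C \<subseteq> N k - U" using mem_cyl_self unfolding N_def C_def by blast
    then have "measure M C \<le> measure M (N k - U)"
      by (rule measure_mono_fmeasurable[OF _ C_sets fm(1)])
    also have "\<dots> = measure M (N k) - measure M (N k \<inter> U)"
    proof -
      have "N k \<inter> U \<union> (N k - U) = N k" "N k - U - N k \<inter> U = N k - U" by auto
      then show ?thesis using measure_Un2[OF fm(2,1)] by simp
    qed
    finally show ?thesis using ge by (simp add: algebra_simps)
  qed
  have "(\<lambda>k. measure M (N k)) \<longlonglongrightarrow> measure M (\<Inter>k. N k)"
  proof (rule Lim_measure_decseq)
    show "decseq N"
      unfolding decseq_def N_def using cyl_mono by blast
  qed (use N_sets fmeasurableD2[OF N_fm] in auto)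
  then have "(\<lambda>k. (1 - \<kappa>) * measure M (N k)) \<longlonglongrightarrow> (1 - \<kappa>) * measure M C"
    unfolding C_eq by (rule tendsto_mult_left)
  then have "measure M C \<le> (1 - \<kappa>) * measure M C"
    using le by (intro LIMSEQ_le_const) auto
  then have "measure M C = 0"
    using assms(2) measure_nonneg[of M C] by (simp add: algebra_simps mult_le_0_iff)
  moreover have "C \<in> fmeasurable M"
    using fmeasurableI2[OF fmeasurable_cyl[of b 0] _ C_sets] by (auto simp: C_def)
  ultimately have "C \<in> null_sets M"
    by (auto simp: null_sets_def emeasure_eq_measure2 C_sets)
  then have "AE f in M. f \<notin> C" by (rule AE_not_in)
  then show "AE f in M. f \<in> cyl b 0 \<longrightarrow> f \<in> U"
    by eventually_elim (auto simp: C_def)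
qed

end

section \<open>Approximation by reduced fractions\<close>

text \<open>If the capped series converged, its terms would tend to 0, so the cap would be inactive
  from some index on. This permits weights as small as the quasi-independence argument
  demands.\<close>

lemma not_summable_truncated:
  assumes "1 < q" "\<not> summable (\<lambda>m. 1 / q ^ s m :: real)"
  shows "\<not> summable (\<lambda>m. 1 / q ^ max (s m) s0)"
proof
  assume *: "summable (\<lambda>m. 1 / q ^ max (s m) s0)"
  then have "(\<lambda>m. 1 / q ^ max (s m) s0) \<longlonglongrightarrow> 0" by (rule summable_LIMSEQ_zero)
  then have "\<forall>\<^sub>F m in sequentially. 1 / q ^ max (s m) s0 < 1 / q ^ s0"
    using assms(1) by (intro order_tendstoD) auto
  then have "\<forall>\<^sub>F m in sequentially. 1 / q ^ max (s m) s0 = 1 / q ^ s m"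
    by eventually_elim (auto simp: max_def split: if_splits)
  then show False using * assms(2) by (subst (asm) summable_cong) auto
qed

context haar
begin

text \<open>The 4 comes from the sieve and \<open>CARD('a) ^ (2 * degree Z)\<close> from the fixed
  factor \<open>Z\<close> of the denominators. Positivity of \<open>s\<close> puts the depth past
  the separation depth, so the neighbourhoods are disjoint and their measures add up
  exactly.\<close>

lemma measure_fracs_nbhd_ge:
  fixes Z :: "'a poly"
  assumes "Z \<noteq> 0" and linear: "\<And>D. D \<in> monics 1 \<Longrightarrow> D dvd Z"
    and "k \<le> m" "4 * m \<le> CARD('a) ^ (m - k)" "0 < s"
  shows "1 / (4 * real CARD('a) ^ (2 * degree Z)) * (1 / real CARD('a) ^ s) * measure M (cyl b k)
    \<le> measure M ((\<Union>x\<in>fracs Z m. cyl x (2 * (degree Z + m) + s)) \<inter> cyl b k)"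
proof -
  let ?q = "real CARD('a)" and ?r = "2 * (degree Z + m) + s" and ?S = "fracs Z m \<inter> cyl b k"
  have q: "?q > 0" using card_field_ge_2[where 'a = 'a] by simp
  have fin: "finite ?S" using fracs_finite_card_le(1)[of Z k m b] assms(1,3) by simp
  have m: "m + (m - k) + k = 2 * m" using assms(3) by simp
  have "1 / (4 * ?q ^ (2 * degree Z)) * (1 / ?q ^ s) * measure M (cyl b k)
      = ?q ^ (m + (m - k)) / 4 * (measure M (cyl 0 0) / ?q ^ ?r)"
  proof -
    have "?q ^ ?r = ?q ^ (2 * degree Z) * ?q ^ s * ?q ^ (m + (m - k)) * ?q ^ k"
      unfolding power_add[symmetric] using m by (intro arg_cong[where f = "\<lambda>n. ?q ^ n"]) simp
    then show ?thesis using q by (simp add: measure_cyl[of b k])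
  qed
  also have "\<dots> \<le> card ?S * (measure M (cyl 0 0) / ?q ^ ?r)"
    using card_fracs_ge[OF assms(1) linear assms(3,4), of b] by (intro mult_right_mono) auto
  also have "\<dots> = measure M (\<Union>x\<in>?S. cyl x ?r)"
  proof (rule measure_UN_separated_cyl[symmetric, OF fin])
    fix x y assume "x \<in> ?S" "y \<in> ?S" "x \<in> cyl y ?r"
    then show "x = y" using fracs_separation(1)[of Z x m y m ?r] assms(1,5) by auto
  qed
  also have "\<dots> \<le> measure M ((\<Union>x\<in>fracs Z m. cyl x ?r) \<inter> cyl b k)"
  proof (rule measure_mono_fmeasurable)
    show "(\<Union>x\<in>?S. cyl x ?r) \<subseteq> (\<Union>x\<in>fracs Z m. cyl x ?r) \<inter> cyl b k"
      using cyl_subset[of _ b k ?r] assms(3) by auto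
    show "(\<Union>x\<in>?S. cyl x ?r) \<in> sets M" by (intro open_in_sets open_UN ballI open_cyl)
    show "(\<Union>x\<in>fracs Z m. cyl x ?r) \<inter> cyl b k \<in> fmeasurable M"
      by (intro Int_cyl_fmeasurable open_in_sets open_UN ballI open_cyl)
  qed
  finally show ?thesis .
qed

text \<open>Two nested counts: fractions of degree \<open>m\<close> in \<open>cyl b k\<close>, then
  fractions of degree \<open>n\<close> in the neighbourhood of each. The extra 1 in the exponent of
  each count produces the factor \<open>CARD('a) ^ 2\<close>.\<close>

lemma measure_fracs_nbhd_Int_le:
  fixes Z :: "'a poly"
  assumes "Z \<noteq> 0" "k \<le> m" "m < n" "0 < t"
  shows "measure M ((\<Union>x\<in>fracs Z m. cyl x (2 * (degree Z + m) + s)) \<inter>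
      (\<Union>y\<in>fracs Z n. cyl y (2 * (degree Z + n) + t)) \<inter> cyl b k)
    \<le> real CARD('a) ^ 2 * (1 / real CARD('a) ^ s) * (1 / real CARD('a) ^ t) * measure M (cyl b k)"
    (is "measure M (?A \<inter> ?B \<inter> _) \<le> _")
proof -
  let ?q = "real CARD('a)" and ?d = "degree Z"
  let ?r = "2 * (?d + m) + s" and ?r' = "2 * (?d + n) + t"
  have q: "?q > 0" using card_field_ge_2[where 'a = 'a] by simp
  let ?S = "fracs Z m \<inter> cyl b k" and ?T = "\<lambda>x. fracs Z n \<inter> cyl x ?r"
  \<comment> \<open>If the neighbourhood of \<open>x\<close> were any narrower, both centres would
    lie in a common cylinder of depth \<open>2 * ?d + m + n + 1\<close>, which forces
    \<open>m = n\<close>. This is what excludes an additive error: the inner count is used only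
    where its exponent is positive.\<close>
  have key: "?r \<le> 2 * ?d + m + n \<and> y \<in> cyl x ?r"
    if "x \<in> fracs Z m" "y \<in> fracs Z n" "f \<in> cyl x ?r" "f \<in> cyl y ?r'" for x y f
  proof -
    have le: "?r \<le> 2 * ?d + m + n"
    proof (rule ccontr)
      assume "\<not> ?thesis"
      then have "f \<in> cyl x (2 * ?d + m + n + 1)" "f \<in> cyl y (2 * ?d + m + n + 1)"
        using that(3,4) cyl_mono[of "2 * ?d + m + n + 1" ?r x]
          cyl_mono[of "2 * ?d + m + n + 1" ?r' y] assms(3) by auto
      then have "x \<in> cyl y (2 * ?d + m + n + 1)" using cyl_eq cyl_sym by blast
      then show False using fracs_separation(2)[OF assms(1) that(1,2)] assms(3) by auto
    qed
    then have "f \<in> cyl y ?r" using that(4) cyl_mono[of ?r ?r' y] assms(3) by auto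
    then show ?thesis using le that(3) cyl_eq cyl_sym by blast
  qed
  show ?thesis
  proof (cases "?r \<le> 2 * ?d + m + n")
    case False
    then have "?A \<inter> ?B \<inter> cyl b k = {}" using key by blast
    then show ?thesis by simp
  next
    case True
    have fin: "finite ?S" "\<And>x. finite (?T x)"
      using fracs_finite_card_le(1)[of Z _ _ _] assms True by auto
    have "?A \<inter> ?B \<inter> cyl b k \<subseteq> (\<Union>x\<in>?S. \<Union>y\<in>?T x. cyl y ?r')"
    proof
      fix f assume "f \<in> ?A \<inter> ?B \<inter> cyl b k"
      then obtain x y where xy: "x \<in> fracs Z m" "y \<in> fracs Z n" "f \<in> cyl x ?r" "f \<in> cyl y ?r'"
        and f: "f \<in> cyl b k" by blast
      have "f \<in> cyl x k" using xy(3) cyl_mono[of k ?r x] assms(2) by auto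
      then have "x \<in> cyl b k" using f cyl_eq cyl_sym by blast
      then show "f \<in> (\<Union>x\<in>?S. \<Union>y\<in>?T x. cyl y ?r')" using xy key[OF xy] by blast
    qed
    then have "measure M (?A \<inter> ?B \<inter> cyl b k) \<le> measure M (\<Union>x\<in>?S. \<Union>y\<in>?T x. cyl y ?r')"
      using fin by (intro measure_mono_fmeasurable fmeasurable.finite_UN)
        (auto intro!: open_in_sets open_cyl open_Int open_UN)
    also have "\<dots> \<le> (\<Sum>x\<in>?S. measure M (\<Union>y\<in>?T x. cyl y ?r'))"
      using fin by (intro measure_UNION_le) (auto intro!: sets.finite_UN)
    also have "\<dots> \<le> (\<Sum>x\<in>?S. real (CARD('a) ^ (2 * (?d + n) + 1 - ?r)) * (measure M (cyl 0 0) / ?q ^ ?r'))"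
    proof (rule sum_mono)
      fix x
      have "measure M (\<Union>y\<in>?T x. cyl y ?r') \<le> card (?T x) * (measure M (cyl 0 0) / ?q ^ ?r')"
        by (rule measure_UN_cyl_le[OF fin(2)])
      also have "\<dots> \<le> real (CARD('a) ^ (2 * (?d + n) + 1 - ?r)) * (measure M (cyl 0 0) / ?q ^ ?r')"
        using True assms by (intro mult_right_mono of_nat_mono fracs_finite_card_le) auto
      finally show "measure M (\<Union>y\<in>?T x. cyl y ?r') \<le>
        real (CARD('a) ^ (2 * (?d + n) + 1 - ?r)) * (measure M (cyl 0 0) / ?q ^ ?r')" .
    qed
    also have "\<dots> = card ?S * (?q ^ (2 * (?d + n) + 1 - ?r) * (measure M (cyl 0 0) / ?q ^ ?r'))"
      by simp
    also have "\<dots> \<le> real (CARD('a) ^ (2 * (?d + m) + 1 - k)) *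
        (?q ^ (2 * (?d + n) + 1 - ?r) * (measure M (cyl 0 0) / ?q ^ ?r'))"
      using assms by (intro mult_right_mono of_nat_mono fracs_finite_card_le) auto
    also have "\<dots> = ?q ^ 2 * (1 / ?q ^ s) * (1 / ?q ^ t) * measure M (cyl b k)"
    proof -
      have "?q ^ (2 * (?d + m) + 1 - k) * ?q ^ (2 * (?d + n) + 1 - ?r) * (?q ^ s * ?q ^ t * ?q ^ k)
          = ?q ^ 2 * ?q ^ ?r'"
        unfolding power_add[symmetric] using True assms
        by (intro arg_cong[where f = "\<lambda>n. ?q ^ n"]) simp
      then show ?thesis using q by (simp add: measure_cyl[of b k] field_simps)
    qed
    finally show ?thesis .
  qed
qed

lemma AE_infinitely_often_approximable:
  fixes Z :: "'a poly"
  assumes "Z \<noteq> 0" and linear: "\<And>D. D \<in> monics 1 \<Longrightarrow> D dvd Z"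
    and nosum: "\<not> summable (\<lambda>m. 1 / real CARD('a) ^ s m)"
  shows "AE f in M. \<exists>\<^sub>\<infinity>m. \<exists>x\<in>fracs Z m. f \<in> cyl x (2 * (degree Z + m) + s m)"
proof -
  let ?q = "real CARD('a)"
  define c where "c = 1 / (4 * ?q ^ (2 * degree Z))"
  define K where "K = ?q ^ 2"
  have q: "1 < ?q" using card_field_ge_2[where 'a = 'a] by simp
  have cK: "0 < c" "0 < K" using q by (auto simp: c_def K_def)
  obtain s0 where "(1 / ?q) ^ s0 < c / (4 * K)"
    using real_arch_pow_inv[of "c / (4 * K)" "1 / ?q"] cK q by auto
  then have s0: "1 / ?q ^ s0 < c / (4 * K)" by (simp add: power_one_over)
  \<comment> \<open>Truncation at \<open>Suc s0\<close> both caps the weights and makes every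
    \<open>t m\<close> positive, as the disjointness of the neighbourhoods requires.\<close>
  define t where "t m = max (s m) (Suc s0)" for m
  define w where "w m = 1 / ?q ^ t m" for m
  define E where "E m = (\<Union>x\<in>fracs Z m. cyl x (2 * (degree Z + m) + t m))" for m
  have open_E: "open (E m)" for m
    unfolding E_def by (intro open_UN ballI open_cyl)
  have "w m \<le> c / (4 * K)" for m
  proof -
    have "w m \<le> 1 / ?q ^ s0"
      unfolding w_def t_def using q by (intro divide_left_mono power_increasing) auto
    then show ?thesis using s0 by simp
  qed
  moreover have "\<not> summable w"
    unfolding w_def t_def using q nosum by (rule not_summable_truncated)
  moreover have "0 \<le> w m" for m by (simp add: w_def)
  ultimately have dens: "c\<^sup>2 / (8 * K) * measure M (cyl b k) \<le> measure M ((\<Union>m\<in>{a..}. E m) \<inter> cyl b k)"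
    if large: "\<And>m. a \<le> m \<Longrightarrow> k \<le> m \<and> 4 * m \<le> CARD('a) ^ (m - k)" for a b k
  proof (intro measure_UN_ge_if_quasi_independent[where w = w] cK)
    show "E i \<in> sets M" for i using open_E by (rule open_in_sets)
    show "c * w i * measure M (cyl b k) \<le> measure M (E i \<inter> cyl b k)" if "a \<le> i" for i
      unfolding E_def c_def w_def
      using large[OF that] assms(1) linear
      by (intro measure_fracs_nbhd_ge) (auto simp: t_def)
    show "measure M (E i \<inter> E j \<inter> cyl b k) \<le> K * w i * w j * measure M (cyl b k)"
      if "a \<le> i" "i < j" for i j
      unfolding E_def K_def w_def
      using large[OF that(1)] assms(1) that(2)
      by (intro measure_fracs_nbhd_Int_le) (auto simp: t_def)
  qed auto
  have "AE f in M. f \<in> (\<Union>m\<in>{a..}. E m)" for a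
  proof (rule AE_mem_if_uniform_density)
    show "open (\<Union>m\<in>{a..}. E m)" using open_E by blast
    show "0 < c\<^sup>2 / (8 * K)" using cK by simp
    fix b k
    \<comment> \<open>The counts start late for a deep cylinder, but dropping the indices below
      \<open>a'\<close> only shrinks the union and the proportion is the same.\<close>
    obtain a' where a': "\<And>m. a' \<le> m \<Longrightarrow> k \<le> m \<and> 4 * m \<le> CARD('a) ^ (m - k)"
      using eventually_linear_le_power[OF card_field_ge_2] unfolding eventually_sequentially by blast
    have "c\<^sup>2 / (8 * K) * measure M (cyl b k) \<le> measure M ((\<Union>m\<in>{max a a'..}. E m) \<inter> cyl b k)"
      using a' by (intro dens) auto
    also have "\<dots> \<le> measure M ((\<Union>m\<in>{a..}. E m) \<inter> cyl b k)"
      using open_E by (intro measure_mono_fmeasurable Int_cyl_fmeasurable)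
        (auto intro!: open_in_sets open_UN open_Int open_cyl)
    finally show "c\<^sup>2 / (8 * K) * measure M (cyl b k) \<le> measure M ((\<Union>m\<in>{a..}. E m) \<inter> cyl b k)" .
  qed
  then have "AE f in M. \<forall>a. f \<in> (\<Union>m\<in>{a..}. E m)" by (simp add: AE_all_countable)
  then show ?thesis
  proof eventually_elim
    case (elim f)
    show ?case
      unfolding INFM_nat_le
    proof
      fix a
      obtain m x where m: "a \<le> m" "x \<in> fracs Z m" "f \<in> cyl x (2 * (degree Z + m) + t m)"
        using elim[rule_format, of a] by (auto simp: E_def)
      then have "f \<in> cyl x (2 * (degree Z + m) + s m)"
        using cyl_mono[of "2 * (degree Z + m) + s m" "2 * (degree Z + m) + t m" x] by (auto simp: t_def)
      then show "\<exists>m\<ge>a. \<exists>x\<in>fracs Z m. f \<in> cyl x (2 * (degree Z + m) + s m)" using m by blast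
    qed
  qed
qed

end

text \<open>Rounds a value of \<phi> to a radius. The minimum appears because the exponent is a
  natural number. The convergence half uses the left inequality for inclusion and the right one for
  summability; the divergence half uses them the other way round.\<close>

lemma ex_power_between:
  fixes a q :: real
  assumes "0 < a" "1 < q"
  shows "\<exists>s. min a 1 \<le> 1 / q ^ s \<and> 1 / q ^ s \<le> q * a"
proof (cases "1 \<le> a")
  case True
  then have "1 \<le> q * a" using assms mult_mono[of 1 q 1 a] by simp
  then show ?thesis by (intro exI[of _ 0]) simp
next
  case False
  have "\<exists>n. 1 / q ^ n < a"
    using real_arch_pow_inv[of a "1 / q"] assms by (simp add: power_one_over)
  then obtain n where n: "1 / q ^ n < a" "\<And>m. m < n \<Longrightarrow> a \<le> 1 / q ^ m"
    using exists_least_iff[of "\<lambda>n. 1 / q ^ n < a"] by (metis linorder_not_le)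
  then obtain s where s: "n = Suc s" using False by (cases n) auto
  show ?thesis
    using n(1) n(2)[of s] assms False unfolding s by (intro exI[of _ s]) (auto simp: field_simps)
qed

section \<open>The integral and the series\<close>

context
  fixes \<phi> :: "real \<Rightarrow> real" and L :: real
  assumes pos: "\<And>u. 0 \<le> u \<Longrightarrow> 0 < \<phi> (exp u)"
    and lip: "L-lipschitz_on {0..} (\<lambda>u. ln (\<phi> (exp u)))"
begin

lemma phi_pos: "1 \<le> t \<Longrightarrow> 0 < \<phi> t"
  using pos[of "ln t"] by simp

text \<open>Continuity of \<phi> is recovered by writing it as the exponential of its logarithm;
  integrability over bounded intervals follows.\<close>

lemma continuous_on_phi_div: "continuous_on {1..} (\<lambda>t. \<phi> t / t)"
proof -
  have "continuous_on {1..} (ln :: real \<Rightarrow> real)" by (intro continuous_on_ln continuous_on_id) auto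
  then have "continuous_on {1..} (\<lambda>t. exp (ln (\<phi> (exp (ln t)))))"
    by (intro continuous_on_exp continuous_on_compose2[OF lipschitz_on_continuous_on[OF lip]]) auto
  then have "continuous_on {1..} \<phi>"
    by (rule continuous_on_eq) (auto simp: phi_pos)
  then show ?thesis by (intro continuous_intros) auto
qed

lemma phi_le_mult:
  assumes "1 \<le> x" "1 \<le> y" "\<bar>ln x - ln y\<bar> \<le> l"
  shows "\<phi> x \<le> exp (L * l) * \<phi> y"
proof -
  have "\<bar>ln (\<phi> (exp (ln x))) - ln (\<phi> (exp (ln y)))\<bar> \<le> L * \<bar>ln x - ln y\<bar>"
    using lipschitz_onD[OF lip, of "ln x" "ln y"] assms(1,2) by (simp add: dist_real_def)
  also have "\<dots> \<le> L * l" using lipschitz_on_nonneg[OF lip] assms(3) by (intro mult_left_mono)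
  finally have "ln (\<phi> x) \<le> L * l + ln (\<phi> y)" using assms(1,2) by simp
  then have "exp (ln (\<phi> x)) \<le> exp (L * l) * exp (ln (\<phi> y))" by (simp flip: exp_add)
  then show ?thesis using phi_pos assms(1,2) by simp
qed

text \<open>On \<open>{q ^ n..q ^ Suc n}\<close> the Lipschitz bound confines \<phi> to within the
  factor \<Lambda> of \<open>\<phi> (q ^ n)\<close>, which does the work of monotonicity in Cauchy
  condensation. Estimating \<open>1 / t\<close> by its values at the two ends gives the factors
  \<open>q - 1\<close> and \<open>1 - 1 / q\<close>.\<close>

lemma integrable_on_iff_summable:
  assumes "1 < (q::real)"
  shows "(\<lambda>t. \<phi> t / t) integrable_on {1..} \<longleftrightarrow> summable (\<lambda>n. \<phi> (q ^ n))"
proof -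
  let ?g = "\<lambda>t. \<phi> t / t"
  define \<Lambda> where "\<Lambda> = exp (L * ln q)"
  have "0 < \<Lambda>" by (simp add: \<Lambda>_def)
  have q1: "1 \<le> q ^ n" for n using assms by simp
  have g: "?g integrable_on {a..b}" if "1 \<le> a" for a b
    using that by (intro integrable_continuous_real continuous_on_subset[OF continuous_on_phi_div]) auto
  have g_nonneg: "0 \<le> ?g t" if "1 \<le> t" for t using phi_pos[OF that] that by simp
  have compare: "\<phi> t \<le> \<Lambda> * \<phi> (q ^ n)" "\<phi> (q ^ n) \<le> \<Lambda> * \<phi> t"
    if t: "t \<in> {q ^ n..q ^ Suc n}" for t n
  proof -
    have t1: "1 \<le> t" "0 < t" using t q1[of n] by auto
    have "ln (q ^ n) \<le> ln t" "ln t \<le> ln (q ^ Suc n)"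
      using t assms t1 by (auto simp del: power_Suc)
    then have "\<bar>ln t - ln (q ^ n)\<bar> \<le> ln q" "\<bar>ln (q ^ n) - ln t\<bar> \<le> ln q"
      using assms by (auto simp: ln_realpow ln_mult algebra_simps)
    then show "\<phi> t \<le> \<Lambda> * \<phi> (q ^ n)" "\<phi> (q ^ n) \<le> \<Lambda> * \<phi> t"
      unfolding \<Lambda>_def using t1 q1[of n] by (auto intro: phi_le_mult)
  qed
  define J where "J n = integral {q ^ n..q ^ Suc n} ?g" for n
  have qmono: "q ^ n \<le> q ^ Suc n" for n using assms by simp
  have upper: "J n \<le> \<Lambda> * (q - 1) * \<phi> (q ^ n)" for n
  proof -
    have "J n \<le> integral {q ^ n..q ^ Suc n} (\<lambda>_. \<Lambda> * \<phi> (q ^ n) / q ^ n)"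
      unfolding J_def
    proof (rule integral_le[OF g[OF q1]])
      fix t assume t: "t \<in> {q ^ n..q ^ Suc n}"
      show "?g t \<le> \<Lambda> * \<phi> (q ^ n) / q ^ n"
        using compare(1)[OF t] t q1[of n] phi_pos[of "q ^ n"] \<open>0 < \<Lambda>\<close> by (intro frac_le) auto
    qed (rule integrable_const_ivl)
    also have "\<dots> = \<Lambda> * (q - 1) * \<phi> (q ^ n)"
      using assms qmono[of n] by (simp add: field_simps)
    finally show ?thesis .
  qed
  have lower: "(1 - 1 / q) / \<Lambda> * \<phi> (q ^ n) \<le> J n" for n
  proof -
    have "(1 - 1 / q) / \<Lambda> * \<phi> (q ^ n) = (q ^ Suc n - q ^ n) * (\<phi> (q ^ n) / \<Lambda> / q ^ Suc n)"
      using assms \<open>0 < \<Lambda>\<close> by (simp add: divide_simps) (simp add: algebra_simps)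
    also have "\<dots> = integral {q ^ n..q ^ Suc n} (\<lambda>_. \<phi> (q ^ n) / \<Lambda> / q ^ Suc n)"
      using qmono[of n] by simp
    also have "\<dots> \<le> J n"
      unfolding J_def
    proof (rule integral_le[OF _ g[OF q1]])
      fix t assume t: "t \<in> {q ^ n..q ^ Suc n}"
      have "\<phi> (q ^ n) / \<Lambda> \<le> \<phi> t" using compare(2)[OF t] \<open>0 < \<Lambda>\<close> by (simp add: field_simps)
      then show "\<phi> (q ^ n) / \<Lambda> / q ^ Suc n \<le> ?g t"
        using t q1[of n] phi_pos[of t] by (intro frac_le) auto
    qed (rule integrable_const_ivl)
    finally show ?thesis .
  qed
  have I: "integral {1..q ^ n} ?g = (\<Sum>i<n. J i)" for n
  proof (induction n)
    case (Suc n)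
    have "integral {1..q ^ Suc n} ?g = integral {1..q ^ n} ?g + J n"
      unfolding J_def using g q1 qmono by (intro Henstock_Kurzweil_Integration.integral_combine[symmetric]) auto
    then show ?case using Suc by simp
  qed simp
  show ?thesis
  proof
    assume int: "?g integrable_on {1..}"
    have "summable (\<lambda>n. (1 - 1 / q) / \<Lambda> * \<phi> (q ^ n))"
    proof (rule summableI_nonneg_bounded)
      fix n
      show "0 \<le> (1 - 1 / q) / \<Lambda> * \<phi> (q ^ n)"
        using phi_pos[OF q1[of n]] assms \<open>0 < \<Lambda>\<close> by simp
      have "(\<Sum>i<n. (1 - 1 / q) / \<Lambda> * \<phi> (q ^ i)) \<le> integral {1..q ^ n} ?g"
        unfolding I by (intro sum_mono lower)
      also have "\<dots> \<le> integral {1..} ?g"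
        using int g_nonneg by (intro integral_subset_le g) auto
      finally show "(\<Sum>i<n. (1 - 1 / q) / \<Lambda> * \<phi> (q ^ i)) \<le> integral {1..} ?g" .
    qed
    then show "summable (\<lambda>n. \<phi> (q ^ n))"
      using assms \<open>0 < \<Lambda>\<close> by (simp add: summable_cmult_iff)
  next
    assume sum: "summable (\<lambda>n. \<phi> (q ^ n))"
    \<comment> \<open>Truncations whose integrals are the partial sums of \<open>J\<close>; monotone
      convergence turns their boundedness into integrability on the whole ray.\<close>
    define h where "h n t = (if t \<in> {1..q ^ n} then ?g t else 0)" for n t
    have "?g integrable_on {1..} \<and> ((\<lambda>n. integral {1..} (h n)) \<longlongrightarrow> integral {1..} ?g) sequentially"
    proof (rule monotone_convergence_increasing)
      have restr: "{1..q ^ n} \<inter> {1..} = {1..q ^ n}" for n by auto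
      show "h n integrable_on {1..}" for n
        unfolding h_def integrable_restrict_Int restr by (rule g) simp
      show "h n t \<le> h (Suc n) t" if "t \<in> {1..}" for n t
        using that g_nonneg[of t] qmono[of n] by (auto simp: h_def)
      show "(\<lambda>n. h n t) \<longlonglongrightarrow> ?g t" if "t \<in> {1..}" for t
      proof (rule tendsto_eventually)
        obtain N where "t < q ^ N" using real_arch_pow[OF assms] by blast
        then have "t \<le> q ^ n" if "N \<le> n" for n
          using power_increasing[OF that, of q] assms by linarith
        then show "\<forall>\<^sub>F n in sequentially. h n t = ?g t"
          using that unfolding eventually_sequentially h_def by (intro exI[of _ N]) auto
      qed
      have int_h: "integral {1..} (h n) = (\<Sum>i<n. J i)" for n
        unfolding h_def integral_restrict_Int restr I by (rule refl)
      have "norm (integral {1..} (h n)) \<le> (\<Sum>n. \<Lambda> * (q - 1) * \<phi> (q ^ n))" for n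
      proof -
        have "0 \<le> J i" for i
          unfolding J_def using g_nonneg q1[of i] by (intro integral_nonneg g) auto
        then have "norm (integral {1..} (h n)) = (\<Sum>i<n. J i)"
          unfolding int_h by (simp add: sum_nonneg)
        also have "\<dots> \<le> (\<Sum>i<n. \<Lambda> * (q - 1) * \<phi> (q ^ i))" by (intro sum_mono upper)
        also have "\<dots> \<le> (\<Sum>n. \<Lambda> * (q - 1) * \<phi> (q ^ n))"
          using phi_pos[OF q1] assms \<open>0 < \<Lambda>\<close>
          by (intro sum_le_suminf summable_mult sum) (auto intro: less_imp_le)
        finally show ?thesis .
      qed
      then show "bounded (range (\<lambda>n. integral {1..} (h n)))" by (auto simp: bounded_iff)
    qed
    then show "?g integrable_on {1..}" by blast
  qed
qed

end

section \<open>From cylinders back to couples \<open>(P, Q)\<close>\<close>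

lemma finite_bounded_numerators:
  fixes Q :: "'a::{finite,field} poly"
  assumes "Q \<noteq> 0"
  shows "finite {P. abs_inf (f - embed_poly P / embed_poly Q) \<le> C}" (is "finite ?S")
proof (cases "?S = {}")
  case False
  let ?q = "real CARD('a)"
  have q: "1 < ?q" using card_field_ge_2[where 'a = 'a] by simp
  \<comment> \<open>Numerators are compared with one admissible \<open>P1\<close>, so that the size
    of \<open>f\<close> does not enter: both quotients are within \<open>C\<close> of
    \<open>f\<close>, hence \<open>P - P1\<close> has bounded degree.\<close>
  obtain P1 where P1: "P1 \<in> ?S" using False by blast
  obtain N where N: "C < ?q ^ N" using real_arch_pow[OF q] by blast
  have vanish: "(f - embed_poly P / embed_poly Q) $$ i = 0" if "P \<in> ?S" "i < - int N" for P i
  proof (cases "f - embed_poly P / embed_poly Q = 0")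
    case nz: False
    let ?v = "fls_subdegree (f - embed_poly P / embed_poly Q)"
    have "?q powi (- ?v) < ?q powi (int N)" using that(1) nz N by (simp add: abs_inf_def)
    then have "- int N < ?v"
      using power_int_increasing[of "int N" "- ?v" ?q] q by (cases "int N \<le> - ?v") auto
    then show ?thesis using that(2) by (intro fls_eq0_below_subdegree) auto
  qed simp
  have "P - P1 \<in> polys_lt (Suc (N + degree Q))" if P: "P \<in> ?S" for P
  proof (cases "P = P1")
    case False
    let ?g = "embed_poly (P - P1) / embed_poly Q"
    have g: "?g = (f - embed_poly P1 / embed_poly Q) - (f - embed_poly P / embed_poly Q)"
      by (simp add: embed_poly_diff diff_divide_distrib)
    have "?g * embed_poly Q = embed_poly (P - P1)" using assms by simp
    then have "fls_subdegree ?g - int (degree Q) = - int (degree (P - P1))"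
      using False assms fls_subdegree_mult[of ?g "embed_poly Q"] by (simp add: subdegree_embed_poly)
    moreover have "- int N \<le> fls_subdegree ?g"
    proof (rule fls_subdegree_geI)
      show "?g \<noteq> 0" using False assms by simp
      show "?g $$ i = 0" if "i < - int N" for i
        using vanish[OF P that] vanish[OF P1 that] unfolding g by simp
    qed
    ultimately show ?thesis by (simp add: mem_polys_lt_iff)
  qed (simp add: polys_lt_def)
  then have "(\<lambda>P. P - P1) ` ?S \<subseteq> polys_lt (Suc (N + degree Q))" by (rule image_subsetI)
  then have "finite ((\<lambda>P. P - P1) ` ?S)" by (rule finite_subset) simp
  then show ?thesis by (rule finite_imageD) (simp add: inj_on_def)
qed simp

lemma good_couples_iff_abs_inf:
  fixes Q :: "'a::{finite,field} poly"
  assumes "Q \<noteq> 0" "coprime P Q" "Q0 dvd Q"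
  shows "(P, Q) \<in> good_couples Q0 \<phi> f \<longleftrightarrow> abs_inf (f - embed_poly P / embed_poly Q)
    \<le> \<phi> (real CARD('a) ^ degree Q) / real CARD('a) ^ (2 * degree Q)"
  using assms by (simp add: good_couples_def abs_inf_embed_poly power_mult[symmetric] mult.commute)

lemma (in haar) AE_finite_good_couples:
  assumes sum: "summable (\<lambda>n. \<phi> (real CARD('a) ^ n))" and pos: "\<And>n. 0 < \<phi> (real CARD('a) ^ n)"
  shows "AE f in M. finite (good_couples Q0 \<phi> f)"
proof -
  let ?q = "real CARD('a)"
  have q: "1 < ?q" using card_field_ge_2[where 'a = 'a] by simp
  obtain s where s: "\<And>n. min (\<phi> (?q ^ n)) 1 \<le> 1 / ?q ^ s n" "\<And>n. 1 / ?q ^ s n \<le> ?q * \<phi> (?q ^ n)"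
    using ex_power_between[OF pos q] by metis
  have "summable (\<lambda>n. 1 / ?q ^ s n)"
    by (rule summable_comparison_test[OF _ summable_mult[OF sum, of ?q]]) (use s(2) q in auto)
  from AE_eventually_not_approximable[OF this]
  show ?thesis
  proof eventually_elim
    case (elim f)
    \<comment> \<open>Once \<phi> is below 1, the minimum in the choice of \<open>s\<close> is
      \<phi> itself. Only the degree of \<open>Q\<close> gets bounded by the Borel-Cantelli
      argument; the numerators need the preceding finiteness lemma.\<close>
    have "\<forall>\<^sub>F n in sequentially. \<phi> (?q ^ n) < 1"
      using summable_LIMSEQ_zero[OF sum] by (intro order_tendstoD) auto
    from eventually_conj[OF this elim] obtain N where N: "\<And>n. N \<le> n \<Longrightarrow> \<phi> (?q ^ n) < 1"
      "\<And>P Q. N \<le> degree Q \<Longrightarrow> Q \<noteq> 0 \<Longrightarrow>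
        f \<notin> cyl (embed_poly P / embed_poly Q) (2 * degree Q + s (degree Q))"
      unfolding eventually_sequentially by blast
    have "degree Q < N" if "(P, Q) \<in> good_couples Q0 \<phi> f" for P Q
    proof (rule ccontr)
      let ?n = "degree Q"
      assume "\<not> ?thesis"
      then have n: "N \<le> ?n" by simp
      have Q: "Q \<noteq> 0" "coprime P Q" "Q0 dvd Q" using that by (auto simp: good_couples_def)
      have "abs_inf (f - embed_poly P / embed_poly Q) \<le> \<phi> (?q ^ ?n) / ?q ^ (2 * ?n)"
        using that good_couples_iff_abs_inf[OF Q] by simp
      also have "\<dots> \<le> (1 / ?q ^ s ?n) / ?q ^ (2 * ?n)"
        using s(1)[of ?n] N(1)[OF n] by (intro divide_right_mono) auto
      also have "\<dots> = 1 / ?q ^ (2 * ?n + s ?n)" by (simp add: power_add)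
      finally show False using N(2)[OF n Q(1)] by (simp add: mem_cyl_iff_abs_inf)
    qed
    then have "good_couples Q0 \<phi> f \<subseteq> prod.swap ` (SIGMA Q:polys_lt N - {0}.
        {P. abs_inf (f - embed_poly P / embed_poly Q)
          \<le> \<phi> (abs_inf (embed_poly Q)) / (abs_inf (embed_poly Q))\<^sup>2})"
      by (intro subrelI, unfold pair_in_swap_image) (auto simp: mem_polys_lt_iff good_couples_def)
    moreover have "finite \<dots>"
      by (intro finite_imageI finite_SigmaI finite_bounded_numerators) auto
    ultimately show ?case by (rule finite_subset)
  qed
qed

lemma (in haar) AE_infinite_good_couples:
  fixes Q0 :: "'a poly"
  assumes nosum: "\<not> summable (\<lambda>n. \<phi> (real CARD('a) ^ n))" and pos: "\<And>n. 0 < \<phi> (real CARD('a) ^ n)"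
    and "Q0 \<noteq> 0"
  shows "AE f in M. infinite (good_couples Q0 \<phi> f)"
proof -
  let ?q = "real CARD('a)"
  have q: "1 < ?q" using card_field_ge_2[where 'a = 'a] by simp
  define Z where "Z = Q0 * \<Prod>(monics 1)"
  have Z: "Z \<noteq> 0" "Q0 dvd Z" "\<And>D. D \<in> monics 1 \<Longrightarrow> D dvd Z"
    using assms(3) monic_nonzero by (auto simp: Z_def intro!: dvd_mult dvd_prodI)
  \<comment> \<open>The denominator \<open>Z * Q\<close> has degree \<open>m + degree Z\<close>, so
    \<phi> is sampled at the shifted index.\<close>
  define a where "a m = \<phi> (?q ^ (m + degree Z))" for m
  have a: "0 < a m" for m using pos by (simp add: a_def)
  obtain s where s: "\<And>m. min (a m) 1 \<le> 1 / ?q ^ s m" "\<And>m. 1 / ?q ^ s m \<le> ?q * a m"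
    using ex_power_between[OF a q] by metis
  \<comment> \<open>The successor absorbs the factor \<open>q\<close> lost in rounding:
    \<open>1 / ?q ^ Suc (s m)\<close> is at most \<open>a m\<close>.\<close>
  have "\<not> summable (\<lambda>m. 1 / ?q ^ Suc (s m))"
  proof
    assume "summable (\<lambda>m. 1 / ?q ^ Suc (s m))"
    from summable_mult[OF this, of ?q] have sum_s: "summable (\<lambda>m. 1 / ?q ^ s m)" using q by simp
    have sum_min: "summable (\<lambda>m. min (a m) 1)"
      by (rule summable_comparison_test[OF _ sum_s]) (use s(1) a in \<open>auto intro!: exI[of _ 0] simp: less_imp_le\<close>)
    then have "\<forall>\<^sub>F m in sequentially. min (a m) 1 < 1"
      using summable_LIMSEQ_zero by (intro order_tendstoD) auto
    then have "\<forall>\<^sub>F m in sequentially. min (a m) 1 = a m"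
      by eventually_elim (auto simp: min_def split: if_splits)
    then have "summable a" using sum_min by (subst (asm) summable_cong) auto
    then show False using nosum unfolding a_def by (simp add: summable_iff_shift[of "\<lambda>n. \<phi> (?q ^ n)"])
  qed
  with Z(1,3) have "AE f in M. \<exists>\<^sub>\<infinity>m. \<exists>x\<in>fracs Z m. f \<in> cyl x (2 * (degree Z + m) + Suc (s m))"
    by (rule AE_infinitely_often_approximable)
  then show ?thesis
  proof eventually_elim
    case (elim f)
    let ?I = "{m. \<exists>x\<in>fracs Z m. f \<in> cyl x (2 * (degree Z + m) + Suc (s m))}"
    \<comment> \<open>Infinitude is read off the degrees of the denominators, which avoids choosing
      a couple for each \<open>m\<close>.\<close>
    have "(\<lambda>m. degree Z + m) ` ?I \<subseteq> (\<lambda>(P, Q). degree Q) ` good_couples Q0 \<phi> f"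
    proof clarify
      fix m x assume x: "x \<in> fracs Z m" "f \<in> cyl x (2 * (degree Z + m) + Suc (s m))"
      then obtain P Q where Q: "x = embed_poly P / embed_poly (Z * Q)" "Q \<in> monics m" "coprime P (Z * Q)"
        by (auto simp: fracs_def)
      let ?n = "degree Z + m"
      have n: "degree (Z * Q) = ?n" using Z(1) Q(2) by (rule degree_mult_monic)
      have nz: "Z * Q \<noteq> 0" "Q0 dvd Z * Q" using Z monic_nonzero[OF Q(2)] by auto
      have "abs_inf (f - x) \<le> 1 / ?q ^ (2 * ?n + Suc (s m))"
        using x(2) by (simp add: mem_cyl_iff_abs_inf del: power_Suc)
      also have "\<dots> = (1 / ?q ^ s m) / ?q / ?q ^ (2 * ?n)" by (simp add: power_add)
      also have "\<dots> \<le> \<phi> (?q ^ ?n) / ?q ^ (2 * ?n)"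
        using s(2)[of m] q by (intro divide_right_mono) (auto simp: a_def add.commute field_simps)
      finally have "(P, Z * Q) \<in> good_couples Q0 \<phi> f"
        using good_couples_iff_abs_inf[OF nz(1) Q(3) nz(2), of \<phi> f] n Q(1) by simp
      then show "?n \<in> (\<lambda>(P, Q). degree Q) ` good_couples Q0 \<phi> f" using n by force
    qed
    moreover have "infinite ((\<lambda>m. degree Z + m) ` ?I)"
      using elim by (subst finite_image_iff) (auto simp: INFM_iff_infinite inj_on_def)
    ultimately show ?case using finite_subset by blast
  qed
qed

text \<open>\<open>ln\<close> is total, so positivity of \<phi> on \<open>{1..}\<close> is stated to
  make the logarithm meaningful. The integrand is nonnegative and continuous on
  \<open>{1..}\<close>, so \<open>integrable_on\<close> holds exactly when the improper integral is
  finite.\<close>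

theorem corollary1p3:
  fixes Q0 :: "'a::{finite,field} poly"
    and \<phi> :: "real \<Rightarrow> real"
    and \<mu> :: "'a fls measure"
  assumes "haar_measure \<mu>"
    and "Q0 \<noteq> 0"
    and "\<forall>t\<ge>0. \<phi> t \<ge> 0"
    and "\<forall>u\<ge>0. \<phi> (exp u) > 0"
    and "\<exists>L. L-lipschitz_on {0..} (\<lambda>u. ln (\<phi> (exp u)))"
  shows "(\<not> (\<lambda>t. \<phi> t / t) integrable_on {1..} \<longrightarrow>
            (AE f in \<mu>. infinite (good_couples Q0 \<phi> f))) \<and>
         ((\<lambda>t. \<phi> t / t) integrable_on {1..} \<longrightarrow>
            (AE f in \<mu>. \<not> infinite (good_couples Q0 \<phi> f)))"
proof -
  interpret haar \<mu> by standard (rule assms(1))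
  obtain L where L: "L-lipschitz_on {0..} (\<lambda>u. ln (\<phi> (exp u)))" using assms(5) by blast
  have q: "1 < real CARD('a)" using card_field_ge_2[where 'a = 'a] by simp
  have pos: "0 < \<phi> (exp u)" if "0 \<le> u" for u using assms(4) that by simp
  have "0 < \<phi> (real CARD('a) ^ n)" for n
    using phi_pos[OF pos L] q by simp
  moreover have "(\<lambda>t. \<phi> t / t) integrable_on {1..} \<longleftrightarrow> summable (\<lambda>n. \<phi> (real CARD('a) ^ n))"
    using integrable_on_iff_summable[OF pos L q] .
  ultimately show ?thesis
    using AE_infinite_good_couples[OF _ _ assms(2)] AE_finite_good_couples by simp
qed

end
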